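(* Let $n \geq 2$ and let $A$ be a cyclic permutation group of order $2^n$ on a finite set. For $i \in \{1,\ldots,n\}$ let $k_i$ denote the number of orbits of $A$ of cardinality $2^i$. Then: (1) if $\sum_{i=2}^n k_i = 1$, then $A \notin GR$; (2) if $\sum_{i=2}^n k_i = 2$, $k_1 = 0$ and $k_2 \in \{1,2\}$, then $A \in GR^*(3)$; (3) otherwise, $A \in GR(2)$.
   Context: A cyclic permutation group is a permutation group generated by a single permutation; its order is the number of its elements. A $k$-colored graph $G=(V,E)$ consists of a finite set $V$ and a function $E$ from the 2-element subsets of $V$ to $\{0,\ldots,k-1\}$. An automorphism of $G$ is a permutation of $V$ preserving $E$; $Aut(G)$ is the automorphism group as a permutation group on $V$. $GR(k)$ is the class of permutation groups $(A,V)$ with $A=Aut(G)$ for some $k$-colored graph $G$ on $V$; $GR=\bigcup_k GR(k)$; $GR^*(k)=GR(k)\setminus GR(k-1)$. *)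

theory Defs
  imports "HOL-Algebra.Group_Action" "HOL-Algebra.Generated_Groups" "HOL-Library.Ramsey"
begin

text \<open>
  A permutation group is a pair \<open>(A, V)\<close>, where \<open>A\<close> is a subgroup of the library's symmetric group
  \<^term>\<open>BijGroup V\<close>. Elements of \<^term>\<open>BijGroup V\<close> are extensional (\<open>undefined\<close> outside \<open>V\<close>),
  so each permutation of \<open>V\<close> is represented by exactly one function and \<^term>\<open>card A\<close> is the
  order of the group.
\<close>

definition permutation_group :: "('a \<Rightarrow> 'a) set \<Rightarrow> 'a set \<Rightarrow> bool" where
  "permutation_group A V \<longleftrightarrow> finite V \<and> subgroup A (BijGroup V)"

definition cyclic_permutation_group :: "('a \<Rightarrow> 'a) set \<Rightarrow> 'a set \<Rightarrow> bool" where
  "cyclic_permutation_group A V \<longleftrightarrow>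
     permutation_group A V \<and> (\<exists>g \<in> carrier (BijGroup V). A = generate (BijGroup V) {g})"

definition perm_orbits :: "('a \<Rightarrow> 'a) set \<Rightarrow> 'a set \<Rightarrow> 'a set set" where
  "perm_orbits A V = orbits (BijGroup V\<lparr>carrier := A\<rparr>) V (\<lambda>g. g)"

text \<open>\<^term>\<open>nsets V 2\<close> is the set of 2-element subsets of \<open>V\<close>; the values of \<open>E\<close> elsewhere are
  irrelevant. As usual, not every colour has to occur.\<close>

definition colored_graph :: "nat \<Rightarrow> 'a set \<Rightarrow> ('a set \<Rightarrow> nat) \<Rightarrow> bool" where
  "colored_graph k V E \<longleftrightarrow> finite V \<and> E \<in> nsets V 2 \<rightarrow> {0..<k}"

definition Aut :: "'a set \<Rightarrow> ('a set \<Rightarrow> nat) \<Rightarrow> ('a \<Rightarrow> 'a) set" where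
  "Aut V E = {f \<in> carrier (BijGroup V). \<forall>e \<in> nsets V 2. E (f ` e) = E e}"

definition GR :: "nat \<Rightarrow> (('a \<Rightarrow> 'a) set \<times> 'a set) set" where
  "GR k = {(A, V). permutation_group A V \<and> (\<exists>E. colored_graph k V E \<and> A = Aut V E)}"

definition GR_all :: "(('a \<Rightarrow> 'a) set \<times> 'a set) set" where
  "GR_all = (\<Union>k. GR k)"

text \<open>Meaningful for \<open>k \<ge> 1\<close> only, because of truncated subtraction.\<close>

definition GR_star :: "nat \<Rightarrow> (('a \<Rightarrow> 'a) set \<times> 'a set) set" where
  "GR_star k = GR k - GR (k - 1)"

end

theory Submission
  imports Defs "HOL-Algebra.Multiplicative_Group" "HOL-Computational_Algebra.Primes"
begin

text \<open>
  If only one orbit is longer than two, reflecting it and fixing everything else preserves every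
  invariant colouring. Two orbits, one of them of length four and everything else fixed, can be
  reflected simultaneously in every two-colouring, because each subset of \<open>\<int>/4\<close> is symmetric
  under some \<open>d \<mapsto> c - d\<close>; three colours break this symmetry.

  All other cases start from a small graph on the longest orbits: either two orbits of length at
  least eight, connected through the asymmetric set \<open>{0, 1, 3}\<close>, or three orbits, the second of
  length four and the third of length two or four. The remaining nontrivial orbits are attached in
  order of decreasing length, each to the one attached before, with a complementation in between
  that keeps the degrees of old vertices away from those of new ones. Fixed points are added last,
  one at a time.
\<close>

section \<open>Integer powers of a permutation of finite order\<close>

text \<open>In an invariant colouring, the colour of the edge between \<open>pw i x\<close> and
  \<open>pw j x\<close> depends only on \<open>i - j\<close> up to sign, so a single orbit taken
  alone always admits its reflections; only edges between orbits can exclude them. Between two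
  orbits the colour depends on the difference \<open>d\<close> of the exponents modulo the shorter
  length, and a joint reflection respects these edges exactly when the colouring of the differences
  is invariant under some map from \<open>d\<close> to \<open>c - d\<close>. Three differences with
  pairwise distinct cyclic gaps have no such symmetry; the gaps of \<open>{0, 1, 3}\<close> modulo
  \<open>p\<close> are 1, 2 and \<open>p - 3\<close>. Modulo four, differences \<open>{0, 1}\<close>
  leave only odd \<open>c\<close>, and an odd shift is what a third orbit of even length can detect.
  One orbit carries a cycle because the automorphisms of a cycle are just rotations and reflections.
  The second obstacle is that an automorphism might mix orbits. This is prevented by degrees, which
  explains the complete and empty orbits and most numerical bounds.\<close>

locale cyclic_action =
  fixes \<sigma> :: "'a \<Rightarrow> 'a" and N :: nat
  assumes N_pos: "N > 0" and funpow_N: "\<sigma> ^^ N = id"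
begin

text \<open>Reducing the exponent modulo \<open>N\<close> yields negative powers without an inverse
  function: \<open>pw (- 1)\<close> undoes \<open>\<sigma>\<close>. All powers are total on the
  type, so the algebra of exponents needs no membership conditions.\<close>

definition pw :: "int \<Rightarrow> 'a \<Rightarrow> 'a" where
  "pw i = \<sigma> ^^ nat (i mod int N)"

definition per :: "'a \<Rightarrow> nat" where
  "per x = (LEAST p. p > 0 \<and> pw (int p) x = x)"

definition orb :: "'a \<Rightarrow> 'a set" where
  "orb x = range (\<lambda>i. pw i x)"

lemma pw_int: "pw (int m) = \<sigma> ^^ m"
proof
  fix x
  have "(\<sigma> ^^ N) x = x"
    by (simp add: funpow_N)
  then show "pw (int m) x = (\<sigma> ^^ m) x"
    unfolding pw_def by (simp add: funpow_mod_eq flip: of_nat_mod)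
qed

lemma pw_mod: "pw (i mod int N) = pw i"
  by (simp add: pw_def)

lemma pw_add: "pw (i + j) x = pw i (pw j x)"
proof -
  have "pw (i + j) = pw (int (nat (i mod int N) + nat (j mod int N)))"
    using N_pos by (subst (1 2) pw_mod [symmetric]) (simp add: mod_add_eq)
  then show ?thesis
    unfolding pw_int funpow_add by (simp add: pw_def)
qed

lemma pw_pw [simp]: "pw i (pw j x) = pw (i + j) x"
  by (simp add: pw_add)

lemma pw_0 [simp]: "pw 0 x = x"
  by (simp add: pw_def)

lemma pw_inj [simp]: "pw i x = pw i y \<longleftrightarrow> x = y"
  by (metis pw_0 pw_pw add.left_inverse)

lemma pw_N [simp]: "pw (int N) x = x"
  using pw_int[of N] by (simp add: funpow_N)

lemma per_pos: "per x > 0" and pw_per [simp]: "pw (int (per x)) x = x"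
proof -
  have "\<exists>p. p > 0 \<and> pw (int p) x = x"
    using N_pos by (intro exI[of _ N]) simp
  from LeastI_ex [OF this] show "per x > 0" "pw (int (per x)) x = x"
    unfolding per_def by auto
qed

lemma pw_mult_per: "pw (int (per x) * k) x = x"
proof -
  have nat: "pw (int (per x) * int m) x = x" for m
    by (induction m) (simp_all add: distrib_left pw_add)
  show ?thesis
  proof (cases "k \<ge> 0")
    case True
    then show ?thesis using nat[of "nat k"] by simp
  next
    case False
    then have "pw (- (int (per x) * k)) x = x" using nat[of "nat (- k)"] by simp
    then have "pw (int (per x) * k) (pw (- (int (per x) * k)) x) = pw (int (per x) * k) x"
      by simp
    then show ?thesis by simp
  qed
qed

lemma pw_fixes_iff: "pw i x = x \<longleftrightarrow> int (per x) dvd i"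
proof
  assume "pw i x = x"
  define r where "r = i mod int (per x)"
  have r: "r \<ge> 0" "r < int (per x)" "i = r + int (per x) * (i div int (per x))"
    using per_pos[of x] by (simp_all add: r_def)
  then have "pw r x = x"
    using \<open>pw i x = x\<close> pw_add[of r "int (per x) * (i div int (per x))" x] by (simp only: pw_mult_per)
  have "r = 0"
  proof (rule ccontr)
    assume "r \<noteq> 0"
    then have "per x \<le> nat r"
      unfolding per_def using r \<open>pw r x = x\<close> by (intro Least_le) auto
    then show False using r by linarith
  qed
  then show "int (per x) dvd i" by (auto simp: r_def)
qed (auto simp: pw_mult_per)

lemma pw_eq_iff: "pw i x = pw j x \<longleftrightarrow> int (per x) dvd i - j"
proof -
  have "pw i x = pw j x \<longleftrightarrow> pw (- j) (pw i x) = pw (- j) (pw j x)"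
    by (simp only: pw_inj)
  then show ?thesis by (simp add: pw_fixes_iff)
qed

lemma per_dvd_N: "per x dvd N"
  using pw_fixes_iff[of "int N" x] by simp

lemma pw_cong: "i mod int (per x) = j mod int (per x) \<Longrightarrow> pw i x = pw j x"
  by (simp add: pw_eq_iff mod_eq_dvd_iff)

lemma mem_orb [simp]: "pw i x \<in> orb x"
  by (auto simp: orb_def)

lemma self_orb [simp]: "x \<in> orb x"
  using mem_orb[of 0 x] by simp

lemma orbE: assumes "y \<in> orb x" obtains i where "y = pw i x"
  using assms by (auto simp: orb_def)

lemma orb_eq: "y \<in> orb x \<Longrightarrow> orb y = orb x"
proof -
  have sub: "orb b \<subseteq> orb a" if "b \<in> orb a" for a b
    using that by (auto simp: orb_def)
  assume "y \<in> orb x"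
  then obtain i where "y = pw i x" by (rule orbE)
  then have "x = pw (- i) y" by simp
  then have "x \<in> orb y" by simp
  with \<open>y \<in> orb x\<close> show ?thesis using sub by blast
qed

lemma pw_mem_orb [simp]: "pw i y \<in> orb x \<longleftrightarrow> y \<in> orb x"
proof
  assume "pw i y \<in> orb x"
  then have "orb (pw i y) = orb x" "y = pw (- i) (pw i y)"
    by (simp_all add: orb_eq)
  then show "y \<in> orb x" by (metis mem_orb)
qed (auto simp: orb_def)

lemma orb_disjoint: "y \<notin> orb x \<Longrightarrow> orb x \<inter> orb y = {}"
  using orb_eq self_orb by blast

lemma orb_conv: "orb x = (\<lambda>i. pw i x) ` {0..<int (per x)}"
proof -
  have "pw i x \<in> (\<lambda>i. pw i x) ` {0..<int (per x)}" for i
  proof (rule image_eqI)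
    show "pw i x = pw (i mod int (per x)) x" by (intro pw_cong) simp
  qed (use per_pos[of x] in simp)
  then show ?thesis by (auto simp: orb_def)
qed

lemma card_orb [simp]: "card (orb x) = per x"
proof -
  have "inj_on (\<lambda>i. pw i x) {0..<int (per x)}"
  proof
    fix i j assume "i \<in> {0..<int (per x)}" "j \<in> {0..<int (per x)}" "pw i x = pw j x"
    then have "i mod int (per x) = j mod int (per x)" by (simp only: pw_eq_iff mod_eq_dvd_iff)
    then show "i = j" using \<open>i \<in> _\<close> \<open>j \<in> _\<close>
      by (metis atLeastLessThan_iff mod_pos_pos_trivial)
  qed
  then show ?thesis by (simp add: orb_conv card_image)
qed

lemma finite_orb [simp]: "finite (orb x)"
  by (simp add: orb_conv)

lemma per_orb: "y \<in> orb x \<Longrightarrow> per y = per x"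
  using orb_eq card_orb by metis

lemma per_pw [simp]: "per (pw i x) = per x"
  by (rule per_orb) simp

end

section \<open>Colourings and their automorphisms\<close>

text \<open>The colour type is arbitrary, so a graph is a \<open>bool\<close>-valued colouring and
  complementation a change of colours. The map \<open>f\<close> is unconstrained outside
  \<open>V\<close>; the link to the extensional elements of \<open>Aut\<close> is
  \<open>aut_restrict_iff_mem_Aut\<close>.\<close>

definition aut :: "'a set \<Rightarrow> ('a \<Rightarrow> 'a \<Rightarrow> 'c) \<Rightarrow> ('a \<Rightarrow> 'a) \<Rightarrow> bool" where
  "aut V C f \<longleftrightarrow> bij_betw f V V \<and> (\<forall>u\<in>V. \<forall>v\<in>V. u \<noteq> v \<longrightarrow> C (f u) (f v) = C u v)"

definition cdeg :: "'a set \<Rightarrow> ('a \<Rightarrow> 'a \<Rightarrow> 'c) \<Rightarrow> 'c \<Rightarrow> 'a \<Rightarrow> nat" where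
  "cdeg V C c v = card {u \<in> V. u \<noteq> v \<and> C v u = c}"

lemma aut_bij: "aut V C f \<Longrightarrow> bij_betw f V V"
  and aut_color: "aut V C f \<Longrightarrow> u \<in> V \<Longrightarrow> v \<in> V \<Longrightarrow> u \<noteq> v \<Longrightarrow> C (f u) (f v) = C u v"
  by (auto simp: aut_def)

lemma aut_mem: "aut V C f \<Longrightarrow> v \<in> V \<Longrightarrow> f v \<in> V"
  using aut_bij bij_betwE by blast

lemma aut_eq_iff: "aut V C f \<Longrightarrow> u \<in> V \<Longrightarrow> v \<in> V \<Longrightarrow> f u = f v \<longleftrightarrow> u = v"
  using aut_bij[of V C f] by (metis bij_betw_def inj_on_eq_iff)

text \<open>On a finite set an injective map of \<open>U\<close> into itself is onto, so invariance
  in one direction suffices.\<close>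

lemma aut_subset:
  assumes "aut V C f" "U \<subseteq> V" "finite V" "\<And>v. v \<in> U \<Longrightarrow> f v \<in> U"
  shows "aut U C f"
proof -
  have "inj_on f U"
    using assms aut_bij bij_betw_imp_inj_on inj_on_subset by metis
  moreover have "f ` U = U"
    using assms \<open>inj_on f U\<close> by (intro endo_inj_surj) (auto intro: finite_subset)
  ultimately show ?thesis
    using assms by (auto simp: aut_def bij_betw_def subset_iff)
qed

lemma aut_cong:
  assumes "aut V C f" "\<And>u v. u \<in> V \<Longrightarrow> v \<in> V \<Longrightarrow> u \<noteq> v \<Longrightarrow> C u v = C' u v"
  shows "aut V C' f"
  unfolding aut_def
proof (intro conjI ballI impI)
  show "bij_betw f V V" using assms(1) by (rule aut_bij)
  fix u v assume "u \<in> V" "v \<in> V" "u \<noteq> v"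
  then show "C' (f u) (f v) = C' u v"
    using assms aut_color[OF assms(1)] aut_mem[OF assms(1)] aut_eq_iff[OF assms(1)] by metis
qed

lemma aut_inj_color:
  assumes "aut V (\<lambda>u v. h (C u v)) f" "inj_on h K"
    and "\<And>u v. u \<in> V \<Longrightarrow> v \<in> V \<Longrightarrow> u \<noteq> v \<Longrightarrow> C u v \<in> K"
  shows "aut V C f"
  unfolding aut_def
proof (intro conjI ballI impI)
  show "bij_betw f V V" using assms(1) by (rule aut_bij)
  fix u v assume "u \<in> V" "v \<in> V" "u \<noteq> v"
  then show "C (f u) (f v) = C u v"
    using aut_color[OF assms(1)] aut_mem[OF assms(1)] aut_eq_iff[OF assms(1)] assms(2,3)
    by (metis inj_onD)
qed

text \<open>The invariant that keeps orbits apart: if two orbits have different degrees in some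
  colour, no automorphism moves a vertex from one to the other.\<close>

lemma aut_cdeg:
  assumes "aut V C f" "v \<in> V"
  shows "cdeg V C c (f v) = cdeg V C c v"
proof -
  have "f ` {u \<in> V. u \<noteq> v \<and> C v u = c} = {u \<in> V. u \<noteq> f v \<and> C (f v) u = c}"
  proof
    show "{u \<in> V. u \<noteq> f v \<and> C (f v) u = c} \<subseteq> f ` {u \<in> V. u \<noteq> v \<and> C v u = c}"
    proof
      fix w assume w: "w \<in> {u \<in> V. u \<noteq> f v \<and> C (f v) u = c}"
      then obtain u where u: "u \<in> V" "w = f u"
        using aut_bij[OF assms(1)] by (auto simp: bij_betw_def)
      have "u \<noteq> v" using w u(2) by blast
      then have "C v u = c"
        using w unfolding u(2) by (simp add: aut_color[OF assms(1) assms(2) u(1)])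
      then have "u \<in> {u \<in> V. u \<noteq> v \<and> C v u = c}"
        using u(1) \<open>u \<noteq> v\<close> by simp
      then show "w \<in> f ` {u \<in> V. u \<noteq> v \<and> C v u = c}"
        using u(2) by blast
    qed
  next
    show "f ` {u \<in> V. u \<noteq> v \<and> C v u = c} \<subseteq> {u \<in> V. u \<noteq> f v \<and> C (f v) u = c}"
    proof
      fix w assume "w \<in> f ` {u \<in> V. u \<noteq> v \<and> C v u = c}"
      then obtain u where "w = f u" "u \<in> V" "u \<noteq> v" "C v u = c" by blast
      then show "w \<in> {u \<in> V. u \<noteq> f v \<and> C (f v) u = c}"
        using aut_color[OF assms(1) assms(2), of u] aut_mem[OF assms(1), of u]
          aut_eq_iff[OF assms(1) _ assms(2), of u] by simp
    qed
  qed
  moreover have "inj_on f {u \<in> V. u \<noteq> v \<and> C v u = c}"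
    using bij_betw_imp_inj_on[OF aut_bij[OF assms(1)]] by (rule inj_on_subset) blast
  ultimately show ?thesis
    unfolding cdeg_def using card_image by fastforce
qed

lemma cdeg_Un:
  assumes "finite V" "finite W" "V \<inter> W = {}"
  shows "cdeg (V \<union> W) C c v = cdeg V C c v + cdeg W C c v"
proof -
  have "{u \<in> V \<union> W. u \<noteq> v \<and> C v u = c} = {u \<in> V. u \<noteq> v \<and> C v u = c} \<union> {u \<in> W. u \<noteq> v \<and> C v u = c}"
    by auto
  then show ?thesis
    unfolding cdeg_def using assms by (subst card_Un_disjoint [symmetric]) auto
qed

lemma cdeg_eqI:
  assumes "{u \<in> V. u \<noteq> v \<and> C v u = c} = S"
  shows "cdeg V C c v = card S"
  using assms by (simp add: cdeg_def)

lemma cdeg_geI: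
  assumes "S \<subseteq> {u \<in> V. u \<noteq> v \<and> C v u = c}" "finite V"
  shows "cdeg V C c v \<ge> card S"
  using assms by (auto simp: cdeg_def intro: card_mono)

section \<open>Equivariant maps between orbits, and colourings that determine the group\<close>

context cyclic_action
begin

text \<open>This is the orbit of the pair \<open>(x, y)\<close> under the diagonal action. If
  \<open>per y\<close> divides \<open>per x\<close>, it is the graph of the equivariant map from
  \<open>orb x\<close> to \<open>orb y\<close> that sends \<open>x\<close> to \<open>y\<close>;
  replacing \<open>y\<close> by \<open>pw d y\<close> shifts this map by \<open>d\<close>.\<close>

definition tie :: "'a \<Rightarrow> 'a \<Rightarrow> 'a \<Rightarrow> 'a \<Rightarrow> bool" where
  "tie x y u v \<longleftrightarrow> (\<exists>i. u = pw i x \<and> v = pw i y)"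

lemma tie_pw [simp]: "tie x y (pw i u) (pw i v) \<longleftrightarrow> tie x y u v"
proof -
  have "tie x y (pw j a) (pw j b)" if "tie x y a b" for a b j
    using that unfolding tie_def by (metis pw_pw)
  from this[of u v i] this[of "pw i u" "pw i v" "- i"] show ?thesis by auto
qed

lemma tie_refl [simp]: "tie x y x y"
  unfolding tie_def by (rule exI[of _ 0]) simp

lemma tie_left:
  assumes "per y dvd per x"
  shows "tie x y (pw i x) v \<longleftrightarrow> v = pw i y"
proof
  assume "tie x y (pw i x) v"
  then obtain j where "pw i x = pw j x" "v = pw j y" by (auto simp: tie_def)
  moreover have "int (per y) dvd i - j"
    using calculation assms by (meson dvd_trans int_dvd_int_iff pw_eq_iff)
  ultimately show "v = pw i y"
    by (simp add: pw_eq_iff dvd_diff_commute)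
qed auto

text \<open>The fibres of the equivariant map partition \<open>orb x\<close>, and the action
  permutes them transitively, so they all have the same size.\<close>

lemma card_tie:
  assumes "per y dvd per x" "v \<in> orb y"
  shows "card {u \<in> orb x. tie x y u v} * per y = per x"
proof -
  define F where "F v = {u \<in> orb x. tie x y u v}" for v
  have F: "F (pw i w) = pw i ` F w" for i w
  proof
    show "F (pw i w) \<subseteq> pw i ` F w"
    proof
      fix u assume "u \<in> F (pw i w)"
      then have "u = pw i (pw (- i) u)" "pw (- i) u \<in> F w"
        using tie_pw[of x y i "pw (- i) u" w] by (auto simp: F_def)
      then show "u \<in> pw i ` F w" by blast
    qed
  qed (auto simp: F_def)
  have card: "card (F w) = card (F v)" if "w \<in> orb y" for w
  proof -
    have "w \<in> orb v"
      using that orb_eq[OF assms(2)] by simp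
    then obtain i where "w = pw i v" by (rule orbE)
    then show ?thesis by (simp add: F card_image inj_on_def)
  qed
  have "card (\<Union>w\<in>orb y. F w) = (\<Sum>w\<in>orb y. card (F w))"
  proof (rule card_UN_disjoint)
    have "w = w'" if "u \<in> F w" "u \<in> F w'" for u w w'
    proof -
      obtain i where "u = pw i x" using \<open>u \<in> F w\<close> by (auto simp: F_def orb_def)
      then show ?thesis using that by (simp add: F_def tie_left[OF assms(1)])
    qed
    then show "\<forall>w\<in>orb y. \<forall>w'\<in>orb y. w \<noteq> w' \<longrightarrow> F w \<inter> F w' = {}"
      by blast
  qed (auto simp: F_def)
  also have "\<dots> = card (F v) * per y"
    by (simp add: card)
  also have "(\<Union>w\<in>orb y. F w) = orb x"
  proof
    show "orb x \<subseteq> (\<Union>w\<in>orb y. F w)"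
    proof
      fix u assume "u \<in> orb x"
      then obtain i where "u = pw i x" by (rule orbE)
      then have "pw i y \<in> orb y" "u \<in> F (pw i y)" by (auto simp: F_def)
      then show "u \<in> (\<Union>w\<in>orb y. F w)" by blast
    qed
  qed (auto simp: F_def)
  finally show ?thesis by (simp add: F_def)
qed

text \<open>Invariance of \<open>V\<close> and \<open>C\<close> makes every power of
  \<open>\<sigma>\<close> an automorphism; the last condition says that there are no others on
  \<open>V\<close>. Symmetry lets \<open>C\<close> descend to 2-element sets.\<close>

definition represents :: "'a set \<Rightarrow> ('a \<Rightarrow> 'a \<Rightarrow> 'c) \<Rightarrow> bool" where
  "represents V C \<longleftrightarrow>
     (\<forall>u\<in>V. \<forall>v\<in>V. C u v = C v u) \<and>
     (\<forall>u\<in>V. \<forall>i. pw i u \<in> V) \<and>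
     (\<forall>u\<in>V. \<forall>v\<in>V. \<forall>i. C (pw i u) (pw i v) = C u v) \<and>
     (\<forall>f. aut V C f \<longrightarrow> (\<exists>i. \<forall>v\<in>V. f v = pw i v))"

lemma representsI:
  assumes "\<And>u v. u \<in> V \<Longrightarrow> v \<in> V \<Longrightarrow> C u v = C v u"
    and "\<And>u i. u \<in> V \<Longrightarrow> pw i u \<in> V"
    and "\<And>u v i. u \<in> V \<Longrightarrow> v \<in> V \<Longrightarrow> C (pw i u) (pw i v) = C u v"
    and "\<And>f. aut V C f \<Longrightarrow> \<exists>i. \<forall>v\<in>V. f v = pw i v"
  shows "represents V C"
  using assms by (auto simp: represents_def)

lemma represents_sym: "represents V C \<Longrightarrow> u \<in> V \<Longrightarrow> v \<in> V \<Longrightarrow> C u v = C v u"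
  and represents_mem: "represents V C \<Longrightarrow> u \<in> V \<Longrightarrow> pw i u \<in> V"
  and represents_pw: "represents V C \<Longrightarrow> u \<in> V \<Longrightarrow> v \<in> V \<Longrightarrow> C (pw i u) (pw i v) = C u v"
  and represents_aut: "represents V C \<Longrightarrow> aut V C f \<Longrightarrow> \<exists>i. \<forall>v\<in>V. f v = pw i v"
  by (auto simp: represents_def)

lemma represents_inj_color:
  assumes "represents V C" "inj_on h K"
    and "\<And>u v. u \<in> V \<Longrightarrow> v \<in> V \<Longrightarrow> u \<noteq> v \<Longrightarrow> C u v \<in> K"
  shows "represents V (\<lambda>u v. h (C u v))"
proof (rule representsI)
  fix f assume "aut V (\<lambda>u v. h (C u v)) f"
  then have "aut V C f" by (rule aut_inj_color[OF _ assms(2,3)])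
  then show "\<exists>i. \<forall>v\<in>V. f v = pw i v" by (rule represents_aut[OF assms(1)])
next
  fix u v assume "u \<in> V" "v \<in> V"
  then show "h (C u v) = h (C v u)"
    using represents_sym[OF assms(1)] by metis
  fix i show "h (C (pw i u) (pw i v)) = h (C u v)"
    using \<open>u \<in> V\<close> \<open>v \<in> V\<close> represents_pw[OF assms(1)] by metis
qed (rule represents_mem[OF assms(1)])

text \<open>A new fixed point joined to everything in one colour can only be confused with a vertex
  that is monochromatic in that colour; no vertex can then be monochromatic in another colour.\<close>

lemma represents_insert_fixed_point:
  fixes C :: "'a \<Rightarrow> 'a \<Rightarrow> 'c"
  assumes rep: "represents V C" and "finite V" "p \<notin> V" "per p = 1" "a \<in> V" "b \<in> V" "a \<noteq> b"
    and "c \<noteq> c'"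
  shows "\<exists>d\<in>{c, c'}. represents (insert p V) (\<lambda>u v. if u = p \<or> v = p then d else C u v)"
proof -
  obtain d where d: "d \<in> {c, c'}" "\<And>w. w \<in> V \<Longrightarrow> \<exists>u\<in>V. u \<noteq> w \<and> C w u \<noteq> d"
  proof (cases "\<exists>w\<in>V. \<forall>u\<in>V. u \<noteq> w \<longrightarrow> C w u = c")
    case True
    then obtain w where w: "w \<in> V" "\<And>u. u \<in> V \<Longrightarrow> u \<noteq> w \<Longrightarrow> C w u = c" by auto
    obtain z where z: "z \<in> V" "z \<noteq> w" using assms(5-7) by blast
    \<comment> \<open>Any \<open>v\<close> other than \<open>w\<close> has an edge of colour
      \<open>c\<close> to \<open>w\<close>, so it is not monochromatic in \<open>c'\<close>. The
      vertex \<open>w\<close> itself needs a second vertex \<open>z\<close>, since on a single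
      vertex every colour is vacuously monochromatic.\<close>
    have "\<exists>u\<in>V. u \<noteq> v \<and> C v u \<noteq> c'" if "v \<in> V" for v
    proof (cases "v = w")
      case True
      then show ?thesis using w(2)[OF z] z assms(8) by (intro bexI[of _ z]) auto
    next
      case False
      then show ?thesis
        using w that assms(8) represents_sym[OF rep that w(1)] by (intro bexI[of _ w]) auto
    qed
    then show ?thesis using that by blast
  next
    case False
    then show ?thesis using that[of c] by blast
  qed
  define D where "D u v = (if u = p \<or> v = p then d else C u v)" for u v
  have fixed: "pw i p = p" for i
    using assms(4) by (simp add: pw_fixes_iff)
  have neq: "u \<noteq> p" if "u \<in> V" for u using that \<open>p \<notin> V\<close> by auto
  have "represents (insert p V) D"
  proof (rule representsI)
    fix f assume f: "aut (insert p V) D f"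
    \<comment> \<open>Edges at \<open>f p\<close> are images of edges at \<open>p\<close>, so they
      would all have colour \<open>d\<close>, which the choice of \<open>d\<close> rules out for
      vertices of \<open>V\<close>.\<close>
    have "f p \<notin> V"
    proof
      assume "f p \<in> V"
      then obtain u where u: "u \<in> V" "u \<noteq> f p" "C (f p) u \<noteq> d" using d(2) by blast
      have "u \<in> f ` insert p V"
        using aut_bij[OF f] u(1) by (simp add: bij_betw_def)
      then obtain w where w: "w \<in> insert p V" "f w = u" by blast
      then have "w \<noteq> p" using u(2) by auto
      then have "D (f p) (f w) = d"
        using aut_color[OF f, of p w] w(1) by (auto simp: D_def)
      then show False
        using u w neq[of u] neq[OF \<open>f p \<in> V\<close>] by (auto simp: D_def)
    qed
    then have fp: "f p = p" using aut_mem[OF f, of p] by auto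
    have fV: "f v \<in> V" if "v \<in> V" for v
      using that aut_mem[OF f, of v] aut_eq_iff[OF f, of v p] fp neq by auto
    have "aut V D f"
      by (rule aut_subset[OF f subset_insertI]) (use assms(2) fV in auto)
    then have "aut V C f"
    proof (rule aut_cong)
      fix u v assume "u \<in> V" "v \<in> V"
      then show "D u v = C u v" unfolding D_def using neq by meson
    qed
    then obtain i where "\<forall>v\<in>V. f v = pw i v" using represents_aut[OF rep] by blast
    then show "\<exists>i. \<forall>v\<in>insert p V. f v = pw i v" using fp fixed by auto
  next
    fix u v i assume "u \<in> insert p V" "v \<in> insert p V"
    then have "C (pw i u) (pw i v) = C u v" if "u \<noteq> p" "v \<noteq> p"
      using represents_pw[OF rep] that by blast
    moreover have "pw i x = p \<longleftrightarrow> x = p" for x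
      using pw_inj[of i x p] fixed[of i] by simp
    ultimately show "D (pw i u) (pw i v) = D u v"
      by (auto simp: D_def)
  next
    fix u v assume "u \<in> insert p V" "v \<in> insert p V"
    then show "D u v = D v u"
      using represents_sym[OF rep, of u v] by (auto simp: D_def)
  qed (use fixed represents_mem[OF rep] in auto)
  then show ?thesis using d(1) unfolding D_def by blast
qed


section \<open>Rotations and reflections of an orbit carrying a cycle\<close>

lemma pw_1_neq: "y \<in> orb x \<Longrightarrow> 2 \<le> per x \<Longrightarrow> pw 1 y \<noteq> y"
  using per_orb[of y x] pw_fixes_iff[of 1 y] by auto

text \<open>An injective map taking cyclic neighbours to cyclic neighbours cannot turn back, so the
  sign \<open>e\<close> of the first step persists. Period at least three ensures that two steps
  forward differ from the starting point.\<close>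

lemma cycle_map:
  assumes M: "per x \<ge> 3" and inj: "inj_on f (orb x)" and "f x \<in> orb x"
    and step: "\<And>u. u \<in> orb x \<Longrightarrow> f (pw 1 u) = pw 1 (f u) \<or> f (pw 1 u) = pw (- 1) (f u)"
  shows "\<exists>k. (\<forall>i. f (pw i x) = pw (k + i) x) \<or> (\<forall>i. f (pw i x) = pw (k - i) x)"
proof -
  obtain k where k: "f x = pw k x" using assms(3) by (rule orbE)
  obtain e :: int where e: "e = 1 \<or> e = - 1" "f (pw 1 x) = pw (k + e) x"
  proof (cases "f (pw 1 x) = pw 1 (f x)")
    case True
    then show ?thesis using that[of 1] k by (simp add: add.commute)
  next
    case False
    then show ?thesis using that[of "-1"] k step[of x] by (simp add: add.commute)
  qed
  \<comment> \<open>Two consecutive values are carried along, because the direction of the next step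
    is found by excluding the value before the current one.\<close>
  have nat: "f (pw (int i) x) = pw (k + e * int i) x \<and>
      f (pw (int i + 1) x) = pw (k + e * (int i + 1)) x" for i
  proof (induction i)
    case 0
    then show ?case using k e by simp
  next
    case (Suc i)
    have "\<not> int (per x) dvd 2"
      using M by (auto dest!: zdvd_imp_le)
    then have "pw (int i + 2) x \<noteq> pw (int i) x"
      by (simp add: pw_eq_iff)
    then have "f (pw (int i + 2) x) \<noteq> f (pw (int i) x)"
      using inj by (simp add: inj_on_eq_iff)
    moreover have "f (pw (int i + 2) x) = pw (1 + (k + e * (int i + 1))) x \<or>
        f (pw (int i + 2) x) = pw (- 1 + (k + e * (int i + 1))) x"
      using step[of "pw (int i + 1) x"] Suc by (simp add: add.commute)
    moreover have "pw (k + e * (int i + 1) - e) x = f (pw (int i) x)"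
      using Suc by (simp add: algebra_simps)
    ultimately have "f (pw (int i + 2) x) = pw (k + e * (int i + 2)) x"
      using e(1) by (auto simp: algebra_simps)
    then show ?case using Suc by (simp add: algebra_simps)
  qed
  have "f (pw i x) = pw (k + e * i) x" for i
  proof -
    \<comment> \<open>A negative exponent is replaced by its nonnegative residue modulo
      \<open>N\<close>, to which the induction applies.\<close>
    define m where "m = nat (i mod int N)"
    have m: "int m = i mod int N" using N_pos by (simp add: m_def)
    then have "pw i = pw (int m)" by (simp add: pw_mod)
    moreover have "pw (k + e * i) = pw (k + e * int m)"
      using m pw_mod[of "k + e * i"] pw_mod[of "k + e * int m"]
      by (metis mod_add_cong mod_mult_right_eq)
    ultimately show ?thesis using nat[of m] by simp
  qed
  then show ?thesis using e(1) by auto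
qed

lemma aut_pw_comp:
  assumes "aut V C f"
    and "\<And>u i. u \<in> V \<Longrightarrow> pw i u \<in> V"
    and "\<And>u v i. u \<in> V \<Longrightarrow> v \<in> V \<Longrightarrow> C (pw i u) (pw i v) = C u v"
  shows "aut V C (\<lambda>u. pw k (f u))"
  unfolding aut_def
proof (intro conjI ballI impI)
  have "bij_betw (pw k) V V"
  proof (rule bij_betwI[where g = "pw (- k)"])
  qed (use assms(2) in auto)
  then show "bij_betw (\<lambda>u. pw k (f u)) V V"
    using bij_betw_trans[OF aut_bij[OF assms(1)]] by (auto simp: comp_def)
  fix u v assume "u \<in> V" "v \<in> V" "u \<noteq> v"
  then show "C (pw k (f u)) (pw k (f v)) = C u v"
    using assms(3)[of "f u" "f v" k] aut_color[OF assms(1)] aut_mem[OF assms(1)] by simp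
qed

text \<open>An orbit carrying a cycle in one of the colours is acted on by rotations and reflections;
  after composing with a rotation, only the identity and one reflection remain.\<close>

lemma representsI_cycle:
  assumes sym: "\<And>u v. u \<in> V \<Longrightarrow> v \<in> V \<Longrightarrow> C u v = C v u"
    and mem: "\<And>u i. u \<in> V \<Longrightarrow> pw i u \<in> V"
    and inv: "\<And>u v i. u \<in> V \<Longrightarrow> v \<in> V \<Longrightarrow> C (pw i u) (pw i v) = C u v"
    and x: "x \<in> V" "per x \<ge> 3"
    and cycle: "\<And>u v. u \<in> orb x \<Longrightarrow> v \<in> orb x \<Longrightarrow> u \<noteq> v \<Longrightarrow>
      C u v = c \<longleftrightarrow> v = pw 1 u \<or> u = pw 1 v"
    and pres: "\<And>f v. aut V C f \<Longrightarrow> v \<in> orb x \<Longrightarrow> f v \<in> orb x"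
    and refl: "\<And>f. aut V C f \<Longrightarrow> \<forall>i. f (pw i x) = pw (- i) x \<Longrightarrow> False"
    and triv: "\<And>f v. aut V C f \<Longrightarrow> \<forall>i. f (pw i x) = pw i x \<Longrightarrow> v \<in> V \<Longrightarrow> f v = v"
  shows "represents V C"
proof (rule representsI)
  fix f assume f: "aut V C f"
  have sub: "orb x \<subseteq> V"
    using mem[OF x(1)] by (auto simp: orb_def)
  have "\<exists>k. (\<forall>i. f (pw i x) = pw (k + i) x) \<or> (\<forall>i. f (pw i x) = pw (k - i) x)"
  proof (rule cycle_map)
    show "inj_on f (orb x)"
      using bij_betw_imp_inj_on[OF aut_bij[OF f]] sub by (rule inj_on_subset)
    show "f x \<in> orb x"
      using f by (rule pres) simp
    fix u assume u: "u \<in> orb x"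
    then have neq: "pw 1 u \<noteq> u"
      using x(2) by (intro pw_1_neq) auto
    have V: "u \<in> V" "pw 1 u \<in> V" using u sub mem by auto
    have "C (f u) (f (pw 1 u)) = c"
      using cycle[of u "pw 1 u"] u neq aut_color[OF f V] by simp
    moreover have "f (pw 1 u) \<noteq> f u"
      using aut_eq_iff[OF f V(2) V(1)] neq by simp
    ultimately have "f (pw 1 u) = pw 1 (f u) \<or> f u = pw 1 (f (pw 1 u))"
      using cycle[of "f u" "f (pw 1 u)"] pres[OF f, of u] pres[OF f, of "pw 1 u"] u by auto
    moreover have "f (pw 1 u) = pw (- 1) (pw 1 (f (pw 1 u)))" by simp
    ultimately show "f (pw 1 u) = pw 1 (f u) \<or> f (pw 1 u) = pw (- 1) (f u)" by metis
  qed (rule x(2))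
  then obtain k where k: "(\<forall>i. f (pw i x) = pw (k + i) x) \<or> (\<forall>i. f (pw i x) = pw (k - i) x)"
    by blast
  have g: "aut V C (\<lambda>u. pw (- k) (f u))"
    using f mem inv by (rule aut_pw_comp)
  from k have "\<forall>i. f (pw i x) = pw (k + i) x"
    using refl[OF g] by auto
  then have "pw (- k) (f v) = v" if "v \<in> V" for v
    using triv[OF g _ that] by auto
  then have "f v = pw k v" if "v \<in> V" for v
    using that pw_pw[of k "- k" "f v"] by simp
  then show "\<exists>i. \<forall>v\<in>V. f v = pw i v" by blast
qed (use sym mem inv in auto)

text \<open>The degree bounds ensure that the vertices of an empty orbit attached to the orbit of \<open>y\<close> by
  \<^const>\<open>tie\<close> have smaller degree than all others; the complement of the enlarged graph then
  satisfies the same bounds for the new orbit.\<close>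

definition extendable :: "'a set \<Rightarrow> ('a \<Rightarrow> 'a \<Rightarrow> bool) \<Rightarrow> 'a \<Rightarrow> bool" where
  "extendable V R y \<longleftrightarrow> finite V \<and> y \<in> V \<and> represents V R \<and>
     (\<forall>v\<in>V. per y < 2 * cdeg V R True v \<and> 1 \<le> cdeg V R False v)"

lemma extendable_step:
  assumes ext: "extendable V R y" and w: "w \<notin> V" "per w dvd per y" "per w \<ge> 2"
  shows "\<exists>R'. extendable (V \<union> orb w) R' w"
proof -
  let ?Y = "orb y" and ?W = "orb w"
  have fin: "finite V" and y: "y \<in> V" and rep: "represents V R"
    and deg: "\<And>v. v \<in> V \<Longrightarrow> per y < 2 * cdeg V R True v"
      "\<And>v. v \<in> V \<Longrightarrow> 1 \<le> cdeg V R False v"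
    using ext by (auto simp: extendable_def)
  note mem = represents_mem[OF rep]
  have Y: "?Y \<subseteq> V" using mem[OF y] by (auto simp: orb_def)
  have disj: "v \<notin> V" if "v \<in> ?W" for v
  proof
    assume "v \<in> V"
    have "w \<in> orb v" using orb_eq[OF that] by simp
    then obtain i where "w = pw i v" by (rule orbE)
    then show False using mem[OF \<open>v \<in> V\<close>] w(1) by simp
  qed
  then have VW: "V \<inter> ?W = {}" by blast
  define D where "D u v \<longleftrightarrow> (u \<in> V \<and> v \<in> V \<and> R u v) \<or> tie y w u v \<or> tie y w v u" for u v
  have tieD: "u \<in> V" "v \<in> ?W" "u \<in> ?Y" if "tie y w u v" for u v
    using that Y by (auto simp: tie_def)
  have D_V: "D u v \<longleftrightarrow> R u v" if "u \<in> V" "v \<in> V" for u v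
    using that tieD[of u v] tieD[of v u] disj by (auto simp: D_def)
  have D_VW: "D u v \<longleftrightarrow> tie y w u v" "D v u \<longleftrightarrow> tie y w u v" if "u \<in> V" "v \<in> ?W" for u v
    using that tieD[of v u] disj[of u] disj[of v] by (auto simp: D_def)
  have D_W: "\<not> D u v" if "u \<in> ?W" "v \<in> ?W" for u v
    using that tieD[of u v] tieD[of v u] disj by (auto simp: D_def)
  have D_pw: "D (pw i u) (pw i v) \<longleftrightarrow> D u v" for i u v
  proof -
    have "pw i x \<in> V \<longleftrightarrow> x \<in> V" for x
      using mem[of "pw i x" "- i"] mem[of x i] by auto
    then show ?thesis using represents_pw[OF rep, of u v i] by (auto simp: D_def)
  qed
  have tie_eq: "v = v'" if "tie y w u v" "tie y w u v'" for u v v'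
  proof -
    have "u \<in> ?Y" using that(1) by (auto simp: tie_def)
    then obtain i where "u = pw i y" by (rule orbE)
    then show ?thesis using that tie_left[OF w(2)] by simp
  qed

  have cdeg: "cdeg (V \<union> ?W) D c v = cdeg V D c v + cdeg ?W D c v" for c v
    using fin VW by (intro cdeg_Un) auto
  have cdeg_V: "cdeg V D c v = cdeg V R c v" if "v \<in> V" for c v
    unfolding cdeg_def using D_V[OF that] by (intro arg_cong[where f = card]) auto
  \<comment> \<open>A new vertex is adjacent only to its fibre in \<open>?Y\<close>, of size
    \<open>per y\<close> divided by \<open>per w\<close>, hence at most half of
    \<open>per y\<close>.\<close>
  have True_W: "2 * cdeg (V \<union> ?W) D True v \<le> per y" if "v \<in> ?W" for v
  proof -
    define F where "F = {u \<in> ?Y. tie y w u v}"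
    have "{u \<in> V \<union> ?W. u \<noteq> v \<and> D v u = True} = F"
      using that D_VW(2)[OF _ that] D_W[OF that] tieD disj Y by (auto simp: F_def)
    then have "cdeg (V \<union> ?W) D True v = card F" by (rule cdeg_eqI)
    moreover have "card F * per w = per y"
      unfolding F_def using w(2) that by (rule card_tie)
    moreover have "card F * 2 \<le> card F * per w" using w(3) by (rule mult_left_mono) simp
    ultimately show ?thesis by simp
  qed
  have False_V: "per w < 2 * cdeg (V \<union> ?W) D False v" if "v \<in> V" for v
  \<comment> \<open>At least \<open>per w - 1\<close> non-neighbours lie in \<open>?W\<close> and
    one more in \<open>V\<close>. The extra one is what makes the bound strict when
    \<open>per w = 2\<close>.\<close>
  proof -
    have "\<exists>z. {u \<in> ?W. tie y w v u} \<subseteq> {z}"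
      using tie_eq by blast
    then obtain z where z: "{u \<in> ?W. tie y w v u} \<subseteq> {z}" by blast
    have "card (?W - {z}) \<le> cdeg ?W D False v"
    proof (rule cdeg_geI)
      show "?W - {z} \<subseteq> {u \<in> ?W. u \<noteq> v \<and> D v u = False}"
        using z that disj D_VW(1)[OF that] by auto
    qed simp
    moreover have "per w - 1 \<le> card (?W - {z})"
      by (simp add: card_Diff_singleton_if)
    ultimately show ?thesis
      using deg(2)[OF that] cdeg_V[OF that] w(3) by (simp add: cdeg)
  qed
  have False_W: "per w < 2 * cdeg (V \<union> ?W) D False v" if "v \<in> ?W" for v
  proof -
    from \<open>v \<in> ?W\<close> obtain i where i: "v = pw i w" by (rule orbE)
    \<comment> \<open>The neighbour of \<open>pw (i + 1) y\<close> in \<open>?W\<close> is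
      \<open>pw 1 v\<close>, which differs from \<open>v\<close> because
      \<open>per w \<ge> 2\<close>. This supplies a non-neighbour of \<open>v\<close> in
      \<open>V\<close>.\<close>
    have "\<not> tie y w (pw (i + 1) y) v"
    proof
      assume "tie y w (pw (i + 1) y) v"
      then have "pw (i + 1) w = v" using tie_left[OF w(2)] by simp
      moreover have "pw 1 v = pw (i + 1) w" using i by (simp add: add.commute)
      ultimately have "pw 1 v = v" by simp
      then show False using pw_1_neq[OF that] w(3) by simp
    qed
    then have "{pw (i + 1) y} \<subseteq> {u \<in> V. u \<noteq> v \<and> D v u = False}"
      using D_VW(2)[OF _ that] disj[OF that] mem[OF y] by auto
    then have "card {pw (i + 1) y} \<le> cdeg V D False v"
      using fin by (rule cdeg_geI)
    moreover have "card (?W - {v}) \<le> cdeg ?W D False v"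
      using D_W[OF that] by (intro cdeg_geI) auto
    ultimately show ?thesis
      using that w(3) by (simp add: cdeg)
  qed
  have True_V: "1 \<le> cdeg (V \<union> ?W) D True v" if "v \<in> V" for v
    using deg(1)[OF that] cdeg_V[OF that, of True] by (simp add: cdeg)
  have True_W': "1 \<le> cdeg (V \<union> ?W) D True v" if "v \<in> ?W" for v
  proof -
    from \<open>v \<in> ?W\<close> obtain i where i: "v = pw i w" by (rule orbE)
    have "card {pw i y} \<le> cdeg V D True v"
      using D_VW(2)[OF _ that] disj[OF that] mem[OF y] i fin by (intro cdeg_geI) auto
    then show ?thesis by (simp add: cdeg)
  qed

  have "represents (V \<union> ?W) D"
  proof (rule representsI)
    fix f assume f: "aut (V \<union> ?W) D f"
    have fV: "f v \<in> V" if "v \<in> V" for v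
    proof (rule ccontr)
      assume "f v \<notin> V"
      then have "f v \<in> ?W" using aut_mem[OF f, of v] that by auto
      then have "2 * cdeg (V \<union> ?W) D True v \<le> per y"
        using True_W aut_cdeg[OF f, of v] that by fastforce
      then show False
        using deg(1)[OF that] cdeg_V[OF that, of True] by (simp add: cdeg)
    qed
    have autV: "aut V R f"
    proof (rule aut_cong)
      show "aut V D f"
        by (rule aut_subset[OF f]) (use fin fV in auto)
    qed (rule D_V)
    then obtain k where k: "\<And>v. v \<in> V \<Longrightarrow> f v = pw k v"
      using represents_aut[OF rep] by blast
    \<comment> \<open>\<open>pw i w\<close> is the only new vertex tied to \<open>pw i y\<close>, so
      its image must be the one tied to \<open>pw (k + i) y\<close>.\<close>
    have "f v = pw k v" if "v \<in> ?W" for v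
    proof -
      have "f v \<in> ?W"
      proof (rule ccontr)
        assume "f v \<notin> ?W"
        then have "f v \<in> V" using aut_mem[OF f, of v] that by auto
        then have "f v \<in> f ` V" using aut_bij[OF autV] by (simp add: bij_betw_def)
        then obtain u where "u \<in> V" "f v = f u" by blast
        then have "v = u" using aut_eq_iff[OF f, of v u] that by simp
        then show False using \<open>u \<in> V\<close> disj[OF that] by simp
      qed
      from \<open>v \<in> ?W\<close> obtain i where i: "v = pw i w" by (rule orbE)
      have yi: "pw i y \<in> V" using mem[OF y] .
      have "D (f (pw i y)) (f v)"
        using aut_color[OF f, of "pw i y" v] yi that disj[OF that] D_VW(1)[OF yi that] i
        by auto
      then have "tie y w (pw (k + i) y) (f v)"
        using D_VW(1)[OF fV[OF yi] \<open>f v \<in> ?W\<close>] k[OF yi] by simp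
      then show ?thesis using tie_left[OF w(2)] i by simp
    qed
    then show "\<exists>i. \<forall>v\<in>V \<union> ?W. f v = pw i v" using k by blast
  next
    show "pw i u \<in> V \<union> ?W" if "u \<in> V \<union> ?W" for u i
      using that mem by auto
    show "D u v = D v u" for u v
      using represents_sym[OF rep, of u v] by (auto simp: D_def)
  qed (rule D_pw)
  then have "represents (V \<union> ?W) (\<lambda>u v. \<not> D u v)"
    by (rule represents_inj_color[where K = UNIV]) (auto simp: inj_on_def)
  moreover have "cdeg (V \<union> ?W) (\<lambda>u v. \<not> D u v) c v = cdeg (V \<union> ?W) D (\<not> c) v" for c v
    by (auto simp: cdeg_def intro!: arg_cong[where f = card])
  ultimately have "extendable (V \<union> ?W) (\<lambda>u v. \<not> D u v) w"
    unfolding extendable_def using fin False_V False_W True_V True_W' by auto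
  then show ?thesis by blast
qed

end

text \<open>An invariant subset of a finite set is mapped onto itself, so by injectivity nothing
  from outside can enter it.\<close>

lemma aut_not_mem:
  assumes "aut V C f" "finite V" "X \<subseteq> V" "\<And>v. v \<in> X \<Longrightarrow> f v \<in> X" "v \<in> V" "v \<notin> X"
  shows "f v \<notin> X"
proof
  assume "f v \<in> X"
  have "f ` X = X"
    using aut_bij[OF aut_subset[OF assms(1,3,2,4)]] by (simp add: bij_betw_def)
  then obtain u where "u \<in> X" "f v = f u" using \<open>f v \<in> X\<close> by blast
  then have "v = u" using aut_eq_iff[OF assms(1,5), of u] assms(3) by auto
  then show False using \<open>u \<in> X\<close> assms(6) by simp
qed

section \<open>Starting graphs on two or three orbits\<close>

context cyclic_action
begin

lemma pw_eq_small: "\<bar>i - j\<bar> < int (per x) \<Longrightarrow> pw i x = pw j x \<Longrightarrow> i = j"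
  using zdvd_not_zless[of "\<bar>i - j\<bar>" "int (per x)"] by (auto simp: pw_eq_iff)

lemma tie_shift:
  assumes "per y dvd per x"
  shows "tie x (pw d y) (pw i x) v \<longleftrightarrow> v = pw (i + d) y"
  using tie_left[of "pw d y" x i v] assms by simp

lemma tie_mem: "tie x y u v \<Longrightarrow> u \<in> orb x \<and> v \<in> orb y"
  by (auto simp: tie_def)

lemma orb_pw [simp]: "orb (pw i x) = orb x"
  by (rule orb_eq) simp

lemma succ_pw [simp]: "pw i v = pw (1 + i) u \<longleftrightarrow> v = pw 1 u"
  using pw_inj[of i v "pw 1 u"] by (simp add: add.commute)

text \<open>Modulo any \<open>p \<ge> 8\<close>, the set \<open>{0, 1, 3}\<close> has neither a translational nor a reflectional
  symmetry.\<close>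

lemma extendable_two_large_orbits:
  assumes y: "y \<notin> orb x" "per y dvd per x" "per y \<ge> 8"
  shows "\<exists>R. extendable (orb x \<union> orb y) R y"
proof -
  let ?X = "orb x" and ?Y = "orb y"
  let ?V = "?X \<union> ?Y"
  let ?p = "int (per y)"
  have M: "per x \<ge> per y" using y(2) per_pos[of x] by (simp add: dvd_imp_le)
  define D where "D u v \<longleftrightarrow> (u \<in> ?X \<and> v = pw 1 u) \<or> (u \<in> ?Y \<and> v \<in> ?Y)
    \<or> tie x y u v \<or> tie x (pw 1 y) u v \<or> tie x (pw 3 y) u v" for u v
  define R where "R u v \<longleftrightarrow> D u v \<or> D v u" for u v
  have disj: "u \<notin> ?Y" if "u \<in> ?X" for u
    using orb_disjoint[OF y(1)] that by auto
  have neq: "pw i x \<noteq> pw j y" "pw j y \<noteq> pw i x" for i j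
    using disj[of "pw i x"] mem_orb by metis+
  have tie_X: "u \<in> ?X" "v \<in> ?Y" if "tie x (pw d y) u v" for d u v
    using tie_mem[OF that] by auto
  have tie_X0: "u \<in> ?X" "v \<in> ?Y" if "tie x y u v" for u v
    using tie_mem[OF that] by auto
  have RX: "R u v \<longleftrightarrow> v = pw 1 u \<or> u = pw 1 v" if "u \<in> ?X" "v \<in> ?X" for u v
    using disj[OF that(1)] disj[OF that(2)] that tie_X tie_X0 unfolding R_def D_def by blast
  have RY: "R u v" if "u \<in> ?Y" "v \<in> ?Y" for u v
    using that by (simp add: R_def D_def)
  have RXY: "R (pw i x) (pw j y) \<longleftrightarrow> (\<exists>d\<in>{0, 1, 3}. pw j y = pw (i + d) y)" for i j
    using disj[of "pw j y"] disj[of "pw i x"] tie_X(2)[of _ "pw j y" "pw i x"]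
      tie_X0(2)[of "pw j y" "pw i x"] neq
      tie_left[OF y(2), of i "pw j y"] tie_shift[OF y(2), of _ i "pw j y"]
    by (auto simp: R_def D_def)
  have RYX: "R (pw j y) (pw i x) \<longleftrightarrow> R (pw i x) (pw j y)" for i j
    by (auto simp: R_def)
  have V_cases: "(\<exists>i. v = pw i x) \<or> (\<exists>i. v = pw i y)" if "v \<in> ?V" for v
    using that by (auto simp: orb_def)
  \<comment> \<open>Two neighbours on the cycle and at most three in \<open>?Y\<close>, against at
    least seven for each vertex of the complete orbit \<open>?Y\<close>.\<close>
  have degX: "cdeg ?V R True (pw i x) \<le> 5" for i
  proof -
    have "{u \<in> ?V. u \<noteq> pw i x \<and> R (pw i x) u = True}
      \<subseteq> set [pw (i + 1) x, pw (i - 1) x, pw i y, pw (i + 1) y, pw (i + 3) y]"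
    proof
      fix u assume u: "u \<in> {u \<in> ?V. u \<noteq> pw i x \<and> R (pw i x) u = True}"
      then have "u \<in> ?V" by blast
      then consider j where "u = pw j x" | j where "u = pw j y" using V_cases by blast
      then show "u \<in> set [pw (i + 1) x, pw (i - 1) x, pw i y, pw (i + 1) y, pw (i + 3) y]"
      proof cases
        case 1
        then have "u = pw 1 (pw i x) \<or> pw i x = pw 1 u" using u RX[of "pw i x" u] by simp
        moreover have "u = pw (- 1) (pw 1 u)" by simp
        ultimately show ?thesis by (metis add.commute insertCI list.set(2) pw_pw uminus_add_conv_diff)
      next
        case 2
        then show ?thesis using u RXY[of i j] by auto
      qed
    qed
    then have "cdeg ?V R True (pw i x)
        \<le> card (set [pw (i + 1) x, pw (i - 1) x, pw i y, pw (i + 1) y, pw (i + 3) y])"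
      unfolding cdeg_def by (rule card_mono[rotated]) simp
    also have "\<dots> \<le> 5"
      by (rule order_trans[OF card_length]) simp
    finally show ?thesis .
  qed
  have degY: "7 \<le> cdeg ?V R True v" if "v \<in> ?Y" for v
  proof -
    have "card (?Y - {v}) \<le> cdeg ?V R True v"
      using RY[OF that] by (intro cdeg_geI) auto
    then show ?thesis using that y(3) by simp
  qed
  \<comment> \<open>At least \<open>per y - 3\<close> vertices of \<open>?Y\<close> are
    non-neighbours, and twice this exceeds \<open>per y\<close> once
    \<open>per y > 6\<close>.\<close>
  have ndegX: "per y < 2 * cdeg ?V R False (pw i x)" for i
  proof -
    have "card (?Y - set [pw i y, pw (i + 1) y, pw (i + 3) y]) \<le> cdeg ?V R False (pw i x)"
      using RXY[of i] neq by (intro cdeg_geI) (auto elim!: orbE)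
    moreover have "card ?Y - card (set [pw i y, pw (i + 1) y, pw (i + 3) y])
        \<le> card (?Y - set [pw i y, pw (i + 1) y, pw (i + 3) y])"
      by (rule diff_card_le_card_Diff) simp
    moreover have "card (set [pw i y, pw (i + 1) y, pw (i + 3) y]) \<le> 3"
      by (rule order_trans[OF card_length]) simp
    ultimately show ?thesis using y(3) unfolding card_orb by linarith
  qed
  have ndegY: "per y < 2 * cdeg ?V R False (pw j y)" for j
  proof -
    \<comment> \<open>Exponents \<open>i\<close> for which \<open>j - i\<close> runs once through
      the residues outside \<open>{0, 1, 3}\<close>: it equals 2 for the first and goes from -1 down
      to \<open>4 - ?p\<close> for the others.\<close>
    let ?S = "insert (j - 2) {j + 1..j + (?p - 4)}"
    have "inj_on (\<lambda>i. pw i x) ?S"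
    proof (rule inj_onI)
      fix a b assume "a \<in> ?S" "b \<in> ?S" "pw a x = pw b x"
      moreover have "\<bar>a - b\<bar> < int (per x)" using \<open>a \<in> ?S\<close> \<open>b \<in> ?S\<close> y(3) M by auto
      ultimately show "a = b" using pw_eq_small by blast
    qed
    then have "card ((\<lambda>i. pw i x) ` ?S) = card ?S" by (rule card_image)
    moreover have "(\<lambda>i. pw i x) ` ?S \<subseteq> {u \<in> ?V. u \<noteq> pw j y \<and> R (pw j y) u = False}"
    proof
      fix u assume "u \<in> (\<lambda>i. pw i x) ` ?S"
      then obtain i where i: "u = pw i x" "i \<in> ?S" by blast
      have "\<not> R (pw i x) (pw j y)"
      proof
        assume "R (pw i x) (pw j y)"
        then obtain d where d: "d \<in> {0, 1, 3}" "pw j y = pw (i + d) y" using RXY by blast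
        then have "j = i + d" using i(2) y(3) by (intro pw_eq_small) auto
        then show False using i(2) d(1) by auto
      qed
      then show "u \<in> {u \<in> ?V. u \<noteq> pw j y \<and> R (pw j y) u = False}"
        using i RYX neq by simp
    qed
    then have "card ((\<lambda>i. pw i x) ` ?S) \<le> cdeg ?V R False (pw j y)"
      by (rule cdeg_geI) simp
    moreover have "card ?S = per y - 3" using y(3) by simp
    ultimately show ?thesis using y(3) by linarith
  qed
  have fX: "f v \<in> ?X" if "aut ?V R f" "v \<in> ?X" for f v
  proof (rule ccontr)
    assume "f v \<notin> ?X"
    then have "f v \<in> ?Y" using aut_mem[OF that(1), of v] that(2) by auto
    then have "7 \<le> cdeg ?V R True v" using degY aut_cdeg[OF that(1), of v True] that(2) by fastforce
    moreover obtain i where "v = pw i x" using \<open>v \<in> ?X\<close> by (rule orbE)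
    ultimately show False using degX[of i] by simp
  qed
  have fY: "\<exists>m. f v = pw m y" if f: "aut ?V R f" and "v \<in> ?Y" for f v
  proof -
    have "f v \<notin> ?X"
      using disj that fX[OF f] by (intro aut_not_mem[OF f]) auto
    then have "f v \<in> ?Y" using aut_mem[OF f, of v] that by auto
    then show ?thesis by (auto simp: orb_def)
  qed
  have fR: "\<exists>d\<in>{0, 1, 3}. pw m y = pw (k + d) y"
    if f: "aut ?V R f" and "f (pw j y) = pw m y" "f (pw i x) = pw k x" "j - i \<in> {0, 1, 3}"
    for f i j k m
  proof -
    have "R (pw i x) (pw j y)"
      unfolding RXY using that(4) by (intro bexI[of _ "j - i"]) auto
    then have "R (pw k x) (pw m y)"
      using aut_color[OF f, of "pw i x" "pw j y"] neq that by simp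
    then show ?thesis by (simp only: RXY)
  qed
  have "represents ?V R"
  proof (rule representsI_cycle)
    show "R u v = R v u" for u v by (auto simp: R_def)
    show "pw i u \<in> ?V" if "u \<in> ?V" for u i using that by auto
    show "R (pw i u) (pw i v) = R u v" for u v i
      by (simp add: R_def D_def)
    show "R u v = True \<longleftrightarrow> v = pw 1 u \<or> u = pw 1 v" if "u \<in> ?X" "v \<in> ?X" for u v
      using RX[OF that] by simp
    show "f v \<in> ?X" if "aut ?V R f" "v \<in> ?X" for f v
      using that by (rule fX)
    fix f assume f: "aut ?V R f"
    {
      assume refl: "\<forall>i. f (pw i x) = pw (- i) x"
      \<comment> \<open>The neighbours \<open>pw 0 x\<close>, \<open>pw (- 1) x\<close>,
        \<open>pw (- 3) x\<close> of \<open>y\<close> are reflected to exponents 0, 1, 3. So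
        \<open>m\<close> must lie in the translates of \<open>{0, 1, 3}\<close> by 0, 1 and 3, which
        have no common element.\<close>
      obtain m where m: "f (pw 0 y) = pw m y" using fY[OF f, of y] by auto
      have "\<exists>d\<in>{0, 1, 3}. pw m y = pw (0 + d) y"
        by (rule fR[OF f m, of "0"]) (use refl refl[rule_format, of 0] in auto)
      then obtain a where a: "a \<in> {0, 1, 3}" "pw m y = pw (0 + a) y" by (rule bexE)
      have "\<exists>d\<in>{0, 1, 3}. pw m y = pw (1 + d) y"
        by (rule fR[OF f m, of "-1"]) (use refl refl[rule_format, of 0] in auto)
      then obtain b where b: "b \<in> {0, 1, 3}" "pw m y = pw (1 + b) y" by (rule bexE)
      have "\<exists>d\<in>{0, 1, 3}. pw m y = pw (3 + d) y"
        by (rule fR[OF f m, of "-3"]) (use refl refl[rule_format, of 0] in auto)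
      then obtain c where c: "c \<in> {0, 1, 3}" "pw m y = pw (3 + c) y" by (rule bexE)
      have "pw (0 + a) y = pw (1 + b) y" "pw (0 + a) y = pw (3 + c) y"
        using a(2) b(2) c(2) by metis+
      \<comment> \<open>All exponents lie between 0 and 6, so with period at least eight congruence
        is equality of integers.\<close>
      then have "0 + a = 1 + b" "0 + a = 3 + c"
        using pw_eq_small[of "0 + a" "1 + b" y] pw_eq_small[of "0 + a" "3 + c" y] a(1) b(1) c(1) y(3)
        by auto
      then show False using a(1) b(1) c(1) by auto
    next
      fix v assume triv: "\<forall>i. f (pw i x) = pw i x" and v: "v \<in> ?V"
      show "f v = v"
      proof (cases "v \<in> ?X")
        case True
        then show ?thesis using triv by (auto elim: orbE)
      next
        case False
        then obtain j where j: "v = pw j y" using V_cases[OF v] by auto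
        then obtain m where m: "f (pw j y) = pw m y" using fY[OF f, of v] by auto
        \<comment> \<open>The fixed neighbours \<open>pw j x\<close>, \<open>pw (j - 1) x\<close>,
          \<open>pw (j - 3) x\<close> confine \<open>m - j\<close> to \<open>{0, 1, 3}\<close>,
          \<open>{-1, 0, 2}\<close> and \<open>{-3, -2, 0}\<close>, whose only common element is
          0.\<close>
        have "\<exists>d\<in>{0, 1, 3}. pw m y = pw (j + d) y"
          by (rule fR[OF f m, of "j"]) (use triv in auto)
        then obtain a where a: "a \<in> {0, 1, 3}" "pw m y = pw (j + a) y" by (rule bexE)
        have "\<exists>d\<in>{0, 1, 3}. pw m y = pw (j - 1 + d) y"
          by (rule fR[OF f m, of "j - 1"]) (use triv in auto)
        then obtain b where b: "b \<in> {0, 1, 3}" "pw m y = pw (j - 1 + b) y" by (rule bexE)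
        have "\<exists>d\<in>{0, 1, 3}. pw m y = pw (j - 3 + d) y"
          by (rule fR[OF f m, of "j - 3"]) (use triv in auto)
        then obtain c where c: "c \<in> {0, 1, 3}" "pw m y = pw (j - 3 + c) y" by (rule bexE)
        have "pw (j + a) y = pw (j - 1 + b) y" "pw (j + a) y = pw (j - 3 + c) y"
          using a(2) b(2) c(2) by metis+
        then have "j + a = j - 1 + b" "j + a = j - 3 + c"
          using pw_eq_small[of "j + a" "j - 1 + b" y] pw_eq_small[of "j + a" "j - 3 + c" y]
            a(1) b(1) c(1) y(3)
          by (auto simp del: pw_inj succ_pw)
        then have "a = 0" using a(1) b(1) c(1) by auto
        then show ?thesis using a(2) j m by simp
      qed
    }
  qed (use y(3) M in auto)
  \<comment> \<open>Degrees at most five on \<open>?X\<close> are too small for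
    \<open>extendable\<close> when \<open>per y\<close> is large; in the complement the computed
    non-degrees become degrees.\<close>
  then have "represents ?V (\<lambda>u v. \<not> R u v)"
    by (rule represents_inj_color[where K = UNIV]) (auto simp: inj_on_def)
  moreover have "cdeg ?V (\<lambda>u v. \<not> R u v) c v = cdeg ?V R (\<not> c) v" for c v
    by (auto simp: cdeg_def intro!: arg_cong[where f = card])
  moreover have "per y < 2 * cdeg ?V R False v \<and> 1 \<le> cdeg ?V R True v" if v: "v \<in> ?V" for v
  proof -
    consider i where "v = pw i x" | i where "v = pw i y" using V_cases[OF v] by blast
    then show ?thesis
    proof cases
      case 1
      have "card {pw i y} \<le> cdeg ?V R True (pw i x)"
        using RXY[of i i] neq by (intro cdeg_geI) auto
      then show ?thesis using 1 ndegX by simp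
    next
      case 2
      then show ?thesis using ndegY degY[of v] by simp
    qed
  qed
  ultimately have "extendable ?V (\<lambda>u v. \<not> R u v) y"
    by (simp add: extendable_def)
  then show ?thesis by blast
qed


lemma orb_four: "per y = 4 \<Longrightarrow> orb y = {pw i y, pw (i + 1) y, pw (i + 2) y, pw (i + 3) y}"
proof -
  assume "per y = 4"
  have "{0..<4} = {0, 1, 2, 3::int}" by auto
  moreover have "orb y = orb (pw i y)" by simp
  ultimately show ?thesis
    using \<open>per y = 4\<close> orb_conv[of "pw i y"] by (simp add: add.commute)
qed

text \<open>Differences 0, 1, 2, 3 modulo four between the orbits receive colours 0, 1, 2, 2. Colour
  0 occurs once, so a reflection of the differences would fix 0 and exchange 1 with 3, whose colours
  differ. Colour 2 also fills \<open>orb y\<close> but is absent from \<open>orb x\<close>, which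
  separates the two orbits by degree.\<close>

lemma represents_three_colors:
  assumes y: "y \<notin> orb x" "per y = 4" "4 dvd per x"
  shows "\<exists>C :: 'a \<Rightarrow> 'a \<Rightarrow> nat. (\<forall>u v. C u v < 3) \<and> represents (orb x \<union> orb y) C"
proof -
  let ?X = "orb x" and ?Y = "orb y"
  let ?V = "?X \<union> ?Y"
  have dvd: "per y dvd per x" using y by simp
  have M: "per x \<ge> 4" using y(3) per_pos[of x] by (simp add: dvd_imp_le)
  have disj: "u \<notin> ?Y" if "u \<in> ?X" for u
    using orb_disjoint[OF y(1)] that by auto
  have neq: "pw i x \<noteq> pw j y" "pw j y \<noteq> pw i x" for i j
    using disj[of "pw i x"] mem_orb by metis+
  define C :: "'a \<Rightarrow> 'a \<Rightarrow> nat" where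
    "C u v = (if u \<in> ?X \<and> v \<in> ?X then if v = pw 1 u \<or> u = pw 1 v then 1 else 0
      else if u \<in> ?Y \<and> v \<in> ?Y then 2
      else if tie x y u v \<or> tie x y v u then 0
      else if tie x (pw 1 y) u v \<or> tie x (pw 1 y) v u then 1 else 2)" for u v
  have CX: "C u v = 1 \<longleftrightarrow> v = pw 1 u \<or> u = pw 1 v" if "u \<in> ?X" "v \<in> ?X" for u v
    using that by (simp add: C_def)
  have CXY: "C (pw i x) (pw j y) =
      (if pw j y = pw i y then 0 else if pw j y = pw (i + 1) y then 1 else 2)" for i j
    using disj[of "pw j y"] disj[of "pw i x"] tie_mem[of x y "pw j y" "pw i x"]
      tie_mem[of x "pw 1 y" "pw j y" "pw i x"] neq
      tie_left[OF dvd, of i "pw j y"] tie_shift[OF dvd, of 1 i "pw j y"]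
    by (auto simp: C_def)
  have V_cases: "(\<exists>i. v = pw i x) \<or> (\<exists>i. v = pw i y)" if "v \<in> ?V" for v
    using that by (auto simp: orb_def)
  have degX: "cdeg ?V C 2 (pw i x) \<le> 2" for i
  proof -
    have "{u \<in> ?V. u \<noteq> pw i x \<and> C (pw i x) u = 2} \<subseteq> {pw (i + 2) y, pw (i + 3) y}"
    proof
      fix u assume u: "u \<in> {u \<in> ?V. u \<noteq> pw i x \<and> C (pw i x) u = 2}"
      have "u \<notin> ?X" using u by (auto simp: C_def split: if_splits)
      then obtain j where j: "u = pw j y" using u by (auto simp: orb_def)
      then have "pw j y \<noteq> pw i y" "pw j y \<noteq> pw (i + 1) y"
        using u CXY[of i j] by (auto split: if_splits)
      moreover have "pw j y \<in> {pw i y, pw (i + 1) y, pw (i + 2) y, pw (i + 3) y}"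
        using orb_four[OF y(2), of i] mem_orb[of j y] by blast
      ultimately show "u \<in> {pw (i + 2) y, pw (i + 3) y}"
        using j by blast
    qed
    then have "cdeg ?V C 2 (pw i x) \<le> card {pw (i + 2) y, pw (i + 3) y}"
      unfolding cdeg_def by (rule card_mono[rotated]) simp
    also have "\<dots> \<le> 2" by (simp add: card_insert_if)
    finally show ?thesis .
  qed
  have degY: "3 \<le> cdeg ?V C 2 v" if "v \<in> ?Y" for v
  proof -
    have "card (?Y - {v}) \<le> cdeg ?V C 2 v"
      using that disj by (intro cdeg_geI) (auto simp: C_def)
    then show ?thesis using that y(2) by simp
  qed
  have fX: "f v \<in> ?X" if "aut ?V C f" "v \<in> ?X" for f v
  proof (rule ccontr)
    assume "f v \<notin> ?X"
    then have "f v \<in> ?Y" using aut_mem[OF that(1), of v] that(2) by auto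
    then have "3 \<le> cdeg ?V C 2 v" using degY aut_cdeg[OF that(1), of v 2] that(2) by fastforce
    moreover obtain i where "v = pw i x" using \<open>v \<in> ?X\<close> by (rule orbE)
    ultimately show False using degX[of i] by simp
  qed
  have fY: "\<exists>m. f v = pw m y" if f: "aut ?V C f" and "v \<in> ?Y" for f v
  proof -
    have "f v \<notin> ?X"
      using disj that fX[OF f] by (intro aut_not_mem[OF f]) auto
    then have "f v \<in> ?Y" using aut_mem[OF f, of v] that by auto
    then show ?thesis by (auto simp: orb_def)
  qed
  \<comment> \<open>Colours 0 and 1 each stand for a single difference, so the image of such an edge
    has the same difference.\<close>
  have fC: "pw m y = pw (k + d) y"
    if f: "aut ?V C f" and "f (pw j y) = pw m y" "f (pw i x) = pw k x" "j - i = d" "d \<in> {0, 1}"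
    for f i j k m d
  proof -
    have "pw (i + 1) y \<noteq> pw i y"
      using pw_eq_small[of "i + 1" i y] y(2) by auto
    moreover have "j = i \<and> d = 0 \<or> j = i + 1 \<and> d = 1" using that(4,5) by auto
    ultimately have "C (pw i x) (pw j y) = nat d"
      unfolding CXY by (elim disjE conjE) simp_all
    then have "C (pw k x) (pw m y) = nat d"
      using aut_color[OF f, of "pw i x" "pw j y"] neq that by simp
    then show ?thesis using that(5) unfolding CXY by (auto split: if_splits)
  qed
  have "represents ?V C"
  proof (rule representsI_cycle)
    show "C u v = C v u" for u v by (auto simp: C_def)
    show "pw i u \<in> ?V" if "u \<in> ?V" for u i using that by auto
    show "C (pw i u) (pw i v) = C u v" for u v i
      by (simp add: C_def)
    show "C u v = 1 \<longleftrightarrow> v = pw 1 u \<or> u = pw 1 v" if "u \<in> ?X" "v \<in> ?X" for u v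
      using CX[OF that] by simp
    show "f v \<in> ?X" if "aut ?V C f" "v \<in> ?X" for f v
      using that by (rule fX)
    fix f assume f: "aut ?V C f"
    {
      assume refl: "\<forall>i. f (pw i x) = pw (- i) x"
      obtain m where m: "f (pw 0 y) = pw m y" using fY[OF f, of y] by auto
      have "pw m y = pw (0 + 0) y"
        by (rule fC[OF f m, of 0]) (use refl refl[rule_format, of 0] in auto)
      \<comment> \<open>\<open>y\<close> has a colour 0 edge to \<open>x\<close> and a colour 1 edge
        to \<open>pw (- 1) x\<close>; after reflecting \<open>orb x\<close> these demand exponents 0
        and 2 for the image of \<open>y\<close>.\<close>
      moreover have "pw m y = pw (1 + 1) y"
        by (rule fC[OF f m, of "-1"]) (use refl in auto)
      ultimately have "pw 0 y = pw 2 y" by simp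
      then show False using pw_eq_small[of 0 2 y] y(2) by simp
    next
      fix v assume triv: "\<forall>i. f (pw i x) = pw i x" and v: "v \<in> ?V"
      show "f v = v"
      proof (cases "v \<in> ?X")
        case True
        then show ?thesis using triv by (auto elim: orbE)
      next
        case False
        then obtain j where j: "v = pw j y" using V_cases[OF v] by auto
        then obtain m where m: "f (pw j y) = pw m y" using fY[OF f, of v] by auto
        have "pw m y = pw (j + 0) y"
          by (rule fC[OF f m, of j]) (use triv in auto)
        then show ?thesis using j m by simp
      qed
    }
  qed (use y(3) M in auto)
  moreover have "C u v < 3" for u v by (simp add: C_def)
  ultimately show ?thesis by blast
qed

text \<open>The edges between the orbits of \<open>x\<close> and \<open>y\<close> are preserved only by reflections that shift
  the two orbits against each other by an odd amount, while the edges to the orbit of \<open>z\<close> force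
  this shift to be even. For \<open>per x = 12\<close> and \<open>per z = 4\<close> the degrees on the orbits of \<open>y\<close> and \<open>z\<close>
  would coincide, hence the assumption on divisibility by three.\<close>

lemma extendable_three_orbits:
  assumes yz: "y \<notin> orb x" "z \<notin> orb x" "z \<notin> orb y"
    and per: "per y = 4" "4 dvd per x" "\<not> 3 dvd per x" "per z \<in> {2, 4}"
  shows "\<exists>R. extendable (orb x \<union> orb y \<union> orb z) R z"
proof -
  let ?X = "orb x" and ?Y = "orb y" and ?Z = "orb z"
  let ?V = "?X \<union> ?Y \<union> ?Z"
  have zy: "per z dvd per y" and yx: "per y dvd per x" using per by auto
  then have zx: "per z dvd per x" by (rule dvd_trans)
  have M: "per x \<ge> 4" using per(2) per_pos[of x] by (simp add: dvd_imp_le)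
  have disj: "u \<notin> ?Y" "u \<notin> ?Z" if "u \<in> ?X" for u
    using orb_disjoint[OF yz(1)] orb_disjoint[OF yz(2)] that by auto
  have disjY: "u \<notin> ?X" "u \<notin> ?Z" if "u \<in> ?Y" for u
    using orb_disjoint[OF yz(1)] orb_disjoint[OF yz(3)] that by auto
  have disjZ: "u \<notin> ?X" "u \<notin> ?Y" if "u \<in> ?Z" for u
    using disj disjY that by auto
  \<comment> \<open>Joining to \<open>?Z\<close> through the complement of \<open>tie\<close> leaves
    each vertex of \<open>?X\<close> and \<open>?Y\<close> exactly one non-neighbour in
    \<open>?Z\<close>, and gives the vertices of \<open>?Z\<close> the degree that
    \<open>extendable\<close> asks for.\<close>
  define D where "D u v \<longleftrightarrow> (u \<in> ?X \<and> v = pw 1 u) \<or> (u \<in> ?Y \<and> v \<in> ?Y)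
    \<or> tie x y u v \<or> tie x (pw 1 y) u v
    \<or> (u \<in> ?X \<and> v \<in> ?Z \<and> \<not> tie x z u v) \<or> (u \<in> ?Y \<and> v \<in> ?Z \<and> \<not> tie y z u v)" for u v
  define R where "R u v \<longleftrightarrow> D u v \<or> D v u" for u v
  have tie_XY: "u \<in> ?X" "v \<in> ?Y" if "tie x (pw d y) u v" for d u v
    using tie_mem[OF that] by auto
  have tie_XY0: "u \<in> ?X" "v \<in> ?Y" if "tie x y u v" for u v
    using tie_mem[OF that] by auto
  have RX: "R u v \<longleftrightarrow> v = pw 1 u \<or> u = pw 1 v" if "u \<in> ?X" "v \<in> ?X" for u v
    using disj[OF that(1)] disj[OF that(2)] that tie_XY tie_XY0 unfolding R_def D_def by blast
  have RY: "R u v" if "u \<in> ?Y" "v \<in> ?Y" for u v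
    using that by (simp add: R_def D_def)
  have RZ: "\<not> R u v" if "u \<in> ?Z" "v \<in> ?Z" for u v
    using disjZ[OF that(1)] disjZ[OF that(2)] that tie_XY tie_XY0 unfolding R_def D_def by blast
  have RXY: "R u v \<longleftrightarrow> tie x y u v \<or> tie x (pw 1 y) u v" if "u \<in> ?X" "v \<in> ?Y" for u v
    using disj[OF that(1)] disjY[OF that(2)] that tie_XY tie_XY0 pw_mem_orb[of 1 v x]
    unfolding R_def D_def by auto
  have RXZ: "R u v \<longleftrightarrow> \<not> tie x z u v" if "u \<in> ?X" "v \<in> ?Z" for u v
    using disj[OF that(1)] disjZ[OF that(2)] that tie_XY tie_XY0 pw_mem_orb[of 1 u x]
    unfolding R_def D_def by auto
  have RYZ: "R u v \<longleftrightarrow> \<not> tie y z u v" if "u \<in> ?Y" "v \<in> ?Z" for u v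
    using disjY[OF that(1)] disjZ[OF that(2)] that tie_XY tie_XY0
    unfolding R_def D_def by auto
  have Rsym: "R u v \<longleftrightarrow> R v u" for u v by (auto simp: R_def)
  have Rpw: "R (pw i u) (pw i v) \<longleftrightarrow> R u v" for i u v by (simp add: R_def D_def)

  have cdeg: "cdeg ?V R c v = cdeg ?X R c v + cdeg ?Y R c v + cdeg ?Z R c v" for c v
  proof -
    have "(?X \<union> ?Y) \<inter> ?Z = {}" "?X \<inter> ?Y = {}" using disj disjY by auto
    then show ?thesis by (simp add: cdeg_Un)
  qed
  have card_tie': "card {u \<in> ?X. tie x y u v} * 4 = per x" "card {u \<in> ?X. tie x (pw 1 y) u v} * 4 = per x"
    if "v \<in> ?Y" for v
    using card_tie[OF yx that] card_tie[of "pw 1 y" x v] yx that per(1) by auto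
  have degX: "cdeg ?V R True v = per z + 3" if v: "v \<in> ?X" for v
  proof -
    obtain i where i: "v = pw i x" using v by (rule orbE)
    have "{u \<in> ?X. u \<noteq> v \<and> R v u = True} = {pw (i + 1) x, pw (i - 1) x}"
    proof -
      have "R v u \<longleftrightarrow> u = pw (i + 1) x \<or> u = pw (i - 1) x" if "u \<in> ?X" for u
      proof -
        have "v = pw 1 u \<longleftrightarrow> u = pw (i - 1) x"
          using pw_inj[of 1 u "pw (i - 1) x"] i by auto
        then show ?thesis using RX[OF v that] i by (simp add: add.commute)
      qed
      moreover have "pw (i + 1) x \<noteq> v" "pw (i - 1) x \<noteq> v"
        using i M pw_eq_small[of "i + 1" i x] pw_eq_small[of "i - 1" i x] by auto
      ultimately show ?thesis by auto
    qed
    moreover have "pw (i + 1) x \<noteq> pw (i - 1) x"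
      using M pw_eq_small[of "i + 1" "i - 1" x] by auto
    ultimately have 1: "cdeg ?X R True v = 2" by (simp add: cdeg_def)
    have "{u \<in> ?Y. u \<noteq> v \<and> R v u = True} = {pw i y, pw (i + 1) y}"
    proof -
      have "R v u \<longleftrightarrow> u = pw i y \<or> u = pw (i + 1) y" if "u \<in> ?Y" for u
        using RXY[OF v that] unfolding i tie_left[OF yx] tie_shift[OF yx] .
      moreover have "pw i y \<in> ?Y" "pw (i + 1) y \<in> ?Y" by simp_all
      ultimately show ?thesis using disj(1)[OF v] by blast
    qed
    moreover have "pw i y \<noteq> pw (i + 1) y"
      using per(1) pw_eq_small[of i "i + 1" y] by auto
    ultimately have 2: "cdeg ?Y R True v = 2" by (simp add: cdeg_def)
    have "{u \<in> ?Z. u \<noteq> v \<and> R v u = True} = ?Z - {pw i z}"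
      using RXZ[OF v] disj[OF v] tie_left[OF zx] i by auto
    then have 3: "cdeg ?Z R True v = per z - 1" by (simp add: cdeg_def)
    show ?thesis using 1 2 3 per(4) by (auto simp: cdeg)
  qed
  have degY: "2 * cdeg ?V R True v = per x + 2 * per z + 4" if v: "v \<in> ?Y" for v
  proof -
    obtain i where i: "v = pw i y" using v by (rule orbE)
    have "{u \<in> ?X. u \<noteq> v \<and> R v u = True} = {u \<in> ?X. tie x y u v} \<union> {u \<in> ?X. tie x (pw 1 y) u v}"
      using RXY[OF _ v] disjY[OF v] Rsym by auto
    moreover have "{u \<in> ?X. tie x y u v} \<inter> {u \<in> ?X. tie x (pw 1 y) u v} = {}"
    proof -
      have False if "tie x y u v" "tie x (pw 1 y) u v" "u \<in> ?X" for u
      proof -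
        obtain j where "u = pw j x" using \<open>u \<in> ?X\<close> by (rule orbE)
        then have "pw j y = pw (j + 1) y"
          using that(1,2) by (metis tie_left[OF yx] tie_shift[OF yx])
        then show False using per(1) pw_eq_small[of j "j + 1" y] by auto
      qed
      then show ?thesis by blast
    qed
    ultimately have "cdeg ?X R True v = card {u \<in> ?X. tie x y u v} + card {u \<in> ?X. tie x (pw 1 y) u v}"
      by (simp add: cdeg_def card_Un_disjoint)
    then have 1: "2 * cdeg ?X R True v = per x" using card_tie'[OF v] by simp
    have "{u \<in> ?Y. u \<noteq> v \<and> R v u = True} = ?Y - {v}"
      using RY[OF v] by auto
    then have 2: "cdeg ?Y R True v = 3" using v per(1) by (simp add: cdeg_def)
    have "{u \<in> ?Z. u \<noteq> v \<and> R v u = True} = ?Z - {pw i z}"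
      using RYZ[OF v] disjY[OF v] tie_left[OF zy] i by auto
    then have 3: "cdeg ?Z R True v = per z - 1" by (simp add: cdeg_def)
    show ?thesis using 1 2 3 per(4) by (auto simp: cdeg)
  qed
  have degZ: "per z * cdeg ?V R True v = (per x + 4) * (per z - 1)" if v: "v \<in> ?Z" for v
  proof -
    have "{u \<in> ?X. u \<noteq> v \<and> R v u = True} = ?X - {u \<in> ?X. tie x z u v}"
      using RXZ[OF _ v] disjZ[OF v] Rsym by auto
    then have "cdeg ?X R True v = per x - card {u \<in> ?X. tie x z u v}"
      by (simp add: cdeg_def card_Diff_subset)
    then have 1: "per z * cdeg ?X R True v = per x * per z - per x"
      using card_tie[OF zx v] by (simp add: diff_mult_distrib2 mult.commute)
    have "{u \<in> ?Y. u \<noteq> v \<and> R v u = True} = ?Y - {u \<in> ?Y. tie y z u v}"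
      using RYZ[OF _ v] disjZ[OF v] Rsym by auto
    then have "cdeg ?Y R True v = per y - card {u \<in> ?Y. tie y z u v}"
      by (simp add: cdeg_def card_Diff_subset)
    then have 2: "per z * cdeg ?Y R True v = per y * per z - per y"
      using card_tie[OF zy v] by (simp add: diff_mult_distrib2 mult.commute)
    have "{u \<in> ?Z. u \<noteq> v \<and> R v u = True} = {}"
      using RZ[OF v] by auto
    then have 3: "cdeg ?Z R True v = 0" by (simp only: cdeg_def card.empty)
    have "per z * cdeg ?V R True v = (per x * per z - per x) + (per y * per z - per y)"
      by (simp add: cdeg distrib_left 1 2 3)
    then show ?thesis using per by (auto simp: algebra_simps)
  qed
  \<comment> \<open>The degrees on \<open>?X\<close>, \<open>?Y\<close>, \<open>?Z\<close> are 5,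
    \<open>per x / 2 + 4\<close>, \<open>per x / 2 + 2\<close> if \<open>per z = 2\<close>, and 7,
    \<open>per x / 2 + 6\<close>, \<open>3 * per x / 4 + 3\<close> if
    \<open>per z = 4\<close>.\<close>
  have neqXY: False if "u \<in> ?X" "v \<in> ?Y" "cdeg ?V R True u = cdeg ?V R True v" for u v
    using degX[OF that(1)] degY[OF that(2)] that(3) M per(4) by auto
  obtain m where m: "per x = 4 * m" using per(2) by (auto elim: dvdE)
  have neqXZ: False if "u \<in> ?X" "v \<in> ?Z" "cdeg ?V R True u = cdeg ?V R True v" for u v
    using degX[OF that(1)] degZ[OF that(2)] that(3) per(3,4) m by auto presburger+
  have neqYZ: False if "u \<in> ?Y" "v \<in> ?Z" "cdeg ?V R True u = cdeg ?V R True v" for u v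
    using degY[OF that(1)] degZ[OF that(2)] that(3) per(3,4) m by auto presburger+
  have V_cases: "v \<in> ?X \<or> v \<in> ?Y \<or> v \<in> ?Z" if "v \<in> ?V" for v using that by auto
  have fdeg: "f v \<in> ?V" "cdeg ?V R True (f v) = cdeg ?V R True v"
    if "aut ?V R f" "v \<in> ?V" for f v
    using aut_mem[OF that] aut_cdeg[OF that] .
  have fX: "f v \<in> ?X" if "aut ?V R f" "v \<in> ?X" for f v
    using fdeg[OF that(1), of v] that(2) V_cases[of "f v"] neqXY[of v "f v"] neqXZ[of v "f v"]
    by auto
  have fY: "f v \<in> ?Y" if "aut ?V R f" "v \<in> ?Y" for f v
    using fdeg[OF that(1), of v] that(2) V_cases[of "f v"] neqXY[of "f v" v] neqYZ[of v "f v"]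
    by auto
  have fZ: "f v \<in> ?Z" if "aut ?V R f" "v \<in> ?Z" for f v
    using fdeg[OF that(1), of v] that(2) V_cases[of "f v"] neqXZ[of "f v" v] neqYZ[of "f v" v]
    by auto
  have fR: "R (f u) (f v) = R u v" if "aut ?V R f" "u \<in> ?V" "v \<in> ?V" "u \<noteq> v" for f u v
    using aut_color[OF that] .
  have ne: "pw i x \<noteq> pw j y" "pw i x \<noteq> pw j z" "pw i y \<noteq> pw j z"
      "x \<noteq> y" "x \<noteq> z" "y \<noteq> z" for i j
    using disj[of "pw i x"] disjY[of "pw i y"] yz mem_orb self_orb by metis+
  \<comment> \<open>The unique non-neighbour of \<open>pw i x\<close> in \<open>?Z\<close> is
    \<open>pw i z\<close>, so the action on \<open>?X\<close> dictates the one on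
    \<open>?Z\<close>.\<close>
  have fz: "f (pw i z) = pw k z" if f: "aut ?V R f" and "f (pw i x) = pw k x" for f i k
  proof -
    have "\<not> R (pw i x) (pw i z)" using RXZ[of "pw i x" "pw i z"] by simp
    then have "\<not> R (pw k x) (f (pw i z))"
      using fR[OF f, of "pw i x" "pw i z"] ne that by simp
    then have "tie x z (pw k x) (f (pw i z))"
      using RXZ[of "pw k x" "f (pw i z)"] fZ[OF f] by simp
    then show ?thesis by (simp only: tie_left[OF zx])
  qed
  \<comment> \<open>Non-edges between \<open>?Y\<close> and \<open>?Z\<close> transport the shift
    from \<open>?Z\<close> to \<open>?Y\<close>, but only modulo \<open>per z\<close>; its parity is
    all that is retained.\<close>
  have fy: "\<exists>m. f (pw j y) = pw m y \<and> even (k - m)"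
    if f: "aut ?V R f" and "f (pw j x) = pw k x" for f j k
  proof -
    obtain m where m: "f (pw j y) = pw m y"
      using fY[OF f, of "pw j y"] by (auto simp: orb_def)
    have "\<not> R (pw j y) (pw j z)" using RYZ[of "pw j y" "pw j z"] by simp
    then have "\<not> R (pw m y) (pw k z)"
      using fR[OF f, of "pw j y" "pw j z"] ne fz[OF that] m by simp
    then have "tie y z (pw m y) (pw k z)"
      using RYZ[of "pw m y" "pw k z"] by simp
    then have "pw k z = pw m z" by (simp only: tie_left[OF zy])
    then have "int (per z) dvd k - m" by (simp add: pw_eq_iff)
    then have "even (k - m)" using per(4) by auto presburger+
    then show ?thesis using m by blast
  qed
  have fxy: "pw m y = pw k y \<or> pw m y = pw (k + 1) y"
    if f: "aut ?V R f" and "f (pw i x) = pw k x" "f (pw j y) = pw m y" "j = i \<or> j = i + 1"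
    for f i j k m
  proof -
    have "R (pw i x) (pw j y)"
      using that(4) RXY[of "pw i x" "pw j y"] tie_left[OF yx] tie_shift[OF yx] by auto
    then have "R (pw k x) (pw m y)"
      using fR[OF f, of "pw i x" "pw j y"] ne that(2,3) by simp
    then show ?thesis
      using RXY[of "pw k x" "pw m y"] by (simp only: tie_left[OF yx] tie_shift[OF yx] mem_orb simp_thms)
  qed
  have fixy: "pw m y = pw k y" if "pw m y = pw k y \<or> pw m y = pw (k + 1) y" "even (k - m)" for k m
  proof -
    have "pw m y \<noteq> pw (k + 1) y"
    proof
      assume "pw m y = pw (k + 1) y"
      then have "4 dvd m - (k + 1)" using per(1) by (simp only: pw_eq_iff) simp
      then show False using that(2) by presburger
    qed
    then show ?thesis using that(1) by simp
  qed
  have "represents ?V R"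
  proof (rule representsI_cycle)
    show "R u v = R v u" for u v by (rule Rsym)
    show "pw i u \<in> ?V" if "u \<in> ?V" for u i using that by auto
    show "R (pw i u) (pw i v) = R u v" for u v i by (rule Rpw)
    show "R u v = True \<longleftrightarrow> v = pw 1 u \<or> u = pw 1 v" if "u \<in> ?X" "v \<in> ?X" for u v
      using RX[OF that] by simp
    show "f v \<in> ?X" if "aut ?V R f" "v \<in> ?X" for f v
      using that by (rule fX)
    fix f assume f: "aut ?V R f"
    {
      \<comment> \<open>\<open>y\<close> is adjacent to \<open>pw 0 x\<close> and
        \<open>pw (- 1) x\<close>. The first edge and parity force the image exponent 0, while the
        reflected second edge allows only 1 or 2 modulo four.\<close>
      assume refl: "\<forall>i. f (pw i x) = pw (- i) x"
      then have refl0: "f (pw 0 x) = pw 0 x" and refl1: "f (pw (- 1) x) = pw 1 x"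
        by (metis minus_zero, metis minus_minus)
      obtain m where m: "f (pw 0 y) = pw m y" "even (0 - m)"
        using fy[OF f refl0] by blast
      have "pw m y = pw 0 y"
        using fixy[OF fxy[OF f refl0 m(1)] m(2)] by simp
      moreover have "pw m y = pw 1 y \<or> pw m y = pw (1 + 1) y"
        using fxy[OF f refl1 m(1)] by simp
      ultimately show False
        using pw_eq_small[of 0 1 y] pw_eq_small[of 0 2 y] per(1) by auto
    next
      fix v assume triv: "\<forall>i. f (pw i x) = pw i x" and v: "v \<in> ?V"
      consider i where "v = pw i x" | i where "v = pw i y" | i where "v = pw i z"
        using V_cases[OF v] by (auto simp: orb_def)
      then show "f v = v"
      proof cases
        case 1
        then show ?thesis using triv by simp
      next
        case 2
        obtain m where m: "f (pw i y) = pw m y" "even (i - m)"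
          using fy[OF f triv[rule_format]] by blast
        have "pw m y = pw i y"
          using fixy[OF fxy[OF f triv[rule_format] m(1)] m(2)] by simp
        then show ?thesis using m 2 by simp
      next
        case 3
        then show ?thesis using fz[OF f triv[rule_format]] by simp
      qed
    }
  qed (use M in auto)
  moreover have "per z < 2 * cdeg ?V R True v \<and> 1 \<le> cdeg ?V R False v" if v: "v \<in> ?V" for v
  proof
    consider "v \<in> ?X" | "v \<in> ?Y" | "v \<in> ?Z" using V_cases[OF v] by blast
    then show "per z < 2 * cdeg ?V R True v"
    proof cases
      case 3
      then have "per z * cdeg ?V R True v \<ge> 8 * (per z - 1)"
        using degZ M by (simp add: mult_le_mono1)
      then show ?thesis using per(4) by auto
    qed (use degX degY in fastforce)+
    have "\<exists>u\<in>?V. u \<noteq> v \<and> \<not> R v u"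
      using V_cases[OF v]
    proof (elim disjE)
      assume "v \<in> ?X"
      then obtain i where "v = pw i x" by (rule orbE)
      then show ?thesis
        using RXZ[of v "pw i z"] ne by (intro bexI[of _ "pw i z"]) auto
    next
      assume "v \<in> ?Y"
      then obtain i where "v = pw i y" by (rule orbE)
      then show ?thesis
        using RYZ[of v "pw i z"] ne by (intro bexI[of _ "pw i z"]) auto
    next
      assume "v \<in> ?Z"
      then obtain i where "v = pw i z" by (rule orbE)
      then show ?thesis
        using RXZ[of "pw i x" v] Rsym ne by (intro bexI[of _ "pw i x"]) auto
    qed
    then obtain u where "u \<in> ?V" "u \<noteq> v" "\<not> R v u" by blast
    then have "card {u} \<le> cdeg ?V R False v" by (intro cdeg_geI) auto
    then show "1 \<le> cdeg ?V R False v" by simp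
  qed
  ultimately have "extendable ?V R z"
    by (simp add: extendable_def)
  then show ?thesis by blast
qed

end

section \<open>Groups of order a power of two\<close>

lemma finite_max_obtain:
  fixes h :: "'b \<Rightarrow> nat"
  assumes "finite S" "S \<noteq> {}"
  obtains m where "m \<in> S" "\<And>x. x \<in> S \<Longrightarrow> h x \<le> h m"
proof -
  have "Max (h ` S) \<in> h ` S" using assms by (intro Max_in) auto
  then obtain m where "m \<in> S" "h m = Max (h ` S)" by fastforce
  then show ?thesis using that[of m] assms by simp
qed

lemma aut_involutionI:
  assumes "\<And>v. v \<in> V \<Longrightarrow> f v \<in> V" "\<And>v. v \<in> V \<Longrightarrow> f (f v) = v"
    and "\<And>u v. u \<in> V \<Longrightarrow> v \<in> V \<Longrightarrow> u \<noteq> v \<Longrightarrow> C (f u) (f v) = C u v"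
  shows "aut V C f"
proof -
  have "bij_betw f V V"
    by (rule bij_betw_byWitness[where f' = f]) (use assms in auto)
  then show ?thesis using assms(3) by (simp add: aut_def)
qed

lemma aut_restrict_iff_mem_Aut:
  "aut V (\<lambda>u v. E {u, v}) f \<longleftrightarrow> restrict f V \<in> Aut V E"
proof -
  have "restrict f V \<in> carrier (BijGroup V) \<longleftrightarrow> bij_betw f V V"
    by (auto simp: BijGroup_def Bij_def intro: bij_betw_cong[THEN iffD1, rotated])
  moreover have "(\<forall>e\<in>nsets V 2. E (restrict f V ` e) = E e) \<longleftrightarrow>
    (\<forall>u\<in>V. \<forall>v\<in>V. u \<noteq> v \<longrightarrow> E {f u, f v} = E {u, v})"
    by (auto simp: nsets_2_eq)
  ultimately show ?thesis by (auto simp: aut_def Aut_def)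
qed

text \<open>If \<open>g 1 = g 3\<close> or \<open>g 0 = g 2\<close>, reflecting with
  \<open>c = 0\<close> or \<open>c = 2\<close> works. Otherwise both pairs use both colours, so
  \<open>g 0\<close> agrees with \<open>g 1\<close> or with \<open>g 3\<close>, and
  \<open>c = 1\<close> or \<open>c = 3\<close> works.\<close>

lemma two_coloring_mod_4_reflection:
  fixes g :: "int \<Rightarrow> nat"
  assumes periodic: "\<And>d. g (d mod 4) = g d" and two: "\<And>d. g d < 2"
  shows "\<exists>c. \<forall>d. g (c - d) = g d"
proof -
  have *: "\<forall>d. g (c - d) = g d"
    if "g (c mod 4) = g 0" "g ((c - 1) mod 4) = g 1" "g ((c - 2) mod 4) = g 2" "g ((c - 3) mod 4) = g 3"
    for c
  proof
    fix d :: int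
    have "d mod 4 \<in> {0, 1, 2, 3}" by auto
    then have "g ((c - d mod 4) mod 4) = g (d mod 4)" using that by auto
    then show "g (c - d) = g d" by (simp only: mod_diff_right_eq periodic)
  qed
  have vals: "g d = 0 \<or> g d = 1" for d using two[of d] by auto
  have "\<exists>c\<in>{0, 1, 2, 3}. \<forall>d. g (c - d) = g d"
  proof (cases "g 1 = g 3 \<or> g 0 = g 2")
    case True
    then show ?thesis using *[of 0] *[of 2] by auto
  next
    case False
    then have "g 0 = g 1 \<and> g 2 = g 3 \<or> g 0 = g 3 \<and> g 1 = g 2"
      using vals[of 0] vals[of 1] vals[of 2] vals[of 3] by auto
    then show ?thesis using *[of 1] *[of 3] by auto
  qed
  then show ?thesis by blast
qed

context cyclic_action
begin

text \<open>A reflection of \<open>orb x\<close>. The exponent is determined only modulo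
  \<open>per x\<close>, so the choice does not affect the result, as \<open>flip_pw\<close>
  shows.\<close>

definition flip :: "'a \<Rightarrow> int \<Rightarrow> 'a \<Rightarrow> 'a" where
  "flip x c u = pw (c - (SOME i. u = pw i x)) x"

lemma flip_pw [simp]: "flip x c (pw i x) = pw (c - i) x"
proof -
  have "pw i x = pw (SOME j. pw i x = pw j x) x"
    by (rule someI) (rule refl)
  then show ?thesis
    unfolding flip_def pw_eq_iff by (simp add: dvd_diff_commute)
qed

text \<open>Each new point is joined in one of the same two colours, so the palette \<open>K\<close>
  does not grow with the number of points.\<close>

lemma represents_insert_fixed_points:
  assumes "represents V C" "\<And>u v. C u v \<in> K" "c \<in> K" "c' \<in> K" "c \<noteq> c'"
    and "finite V" "a \<in> V" "b \<in> V" "a \<noteq> b"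
    and "finite F" "F \<inter> V = {}" "\<And>p. p \<in> F \<Longrightarrow> per p = 1"
  shows "\<exists>C'. represents (F \<union> V) C' \<and> (\<forall>u v. C' u v \<in> K)"
  using assms(10-12)
proof (induction F rule: finite_induct)
  case empty
  then show ?case using assms(1,2) by auto
next
  case (insert p F)
  then obtain C' where C': "represents (F \<union> V) C'" "\<And>u v. C' u v \<in> K" by auto
  obtain d where "d \<in> {c, c'}"
    "represents (insert p (F \<union> V)) (\<lambda>u v. if u = p \<or> v = p then d else C' u v)"
    using represents_insert_fixed_point[OF C'(1) _ _ _ _ _ assms(9,5), of p] insert assms(6-8)
    by auto
  then show ?case
    using C'(2) assms(3,4) by (intro exI[of _ "\<lambda>u v. if u = p \<or> v = p then d else C' u v"]) auto
qed

end

section \<open>Assembling the colourings for a group of two-power order\<close>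

locale two_power_action = cyclic_action \<sigma> N for \<sigma> :: "'a \<Rightarrow> 'a" and N +
  fixes n :: nat and V :: "'a set"
  assumes N_def: "N = 2 ^ n" and finite_V: "finite V"
    and V_pw: "\<And>v i. v \<in> V \<Longrightarrow> pw i v \<in> V"
begin

lemma per_two_power: "\<exists>e\<le>n. per v = 2 ^ e"
  using per_dvd_N[of v] divides_primepow_nat[of 2 "per v" n] by (auto simp: N_def)

text \<open>Among powers of two, size decides divisibility. Hence orbits taken in decreasing length
  can always be connected by equivariant maps.\<close>

lemma per_dvd_per: "per u \<le> per v \<Longrightarrow> per u dvd per v"
  using per_two_power[of u] per_two_power[of v] by (auto simp: le_imp_power_dvd)

lemma not_3_dvd_per: "\<not> 3 dvd per v"
proof
  assume "3 dvd per v"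
  moreover obtain e where "per v = 2 ^ e" using per_two_power by blast
  moreover have "prime (3 :: nat)" by simp
  ultimately have "3 dvd (2 :: nat)" using prime_dvd_power by metis
  then show False by simp
qed

lemma per_less_8_cases: "per v < 8 \<Longrightarrow> per v = 1 \<or> per v = 2 \<or> per v = 4"
proof -
  assume "per v < 8"
  obtain e where e: "per v = 2 ^ e" using per_two_power by blast
  have "e < 3"
  proof (rule ccontr)
    assume "\<not> e < 3"
    then have "(2 :: nat) ^ 3 \<le> 2 ^ e" by (intro power_increasing) auto
    then show False using e \<open>per v < 8\<close> by simp
  qed
  then have "e = 0 \<or> e = 1 \<or> e = 2" by auto
  then show ?thesis using e by auto
qed

lemma orb_subset: "v \<in> V \<Longrightarrow> orb v \<subseteq> V"
  using V_pw by (auto simp: orb_def)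

lemma extendable_extend:
  assumes "extendable U R y" "U \<subseteq> W" "W \<subseteq> V"
    and "\<And>v i. v \<in> W \<Longrightarrow> pw i v \<in> W"
    and "\<And>v. v \<in> W - U \<Longrightarrow> 2 \<le> per v \<and> per v \<le> per y"
  shows "\<exists>R. represents W (R :: 'a \<Rightarrow> 'a \<Rightarrow> bool)"
  using assms(1,2,5)
proof (induction "card (W - U)" arbitrary: U R y rule: less_induct)
  case less
  have fin: "finite W" using assms(3) finite_V by (rule finite_subset)
  show ?case
  proof (cases "W - U = {}")
    case True
    then have "W = U" using less.prems(2) by blast
    then show ?thesis using less.prems(1) by (auto simp: extendable_def)
  next
    case False
    \<comment> \<open>Taking a longest remaining orbit preserves the condition that all later
      periods are at most that of the last attached orbit.\<close>
    obtain w where w: "w \<in> W - U" "\<And>v. v \<in> W - U \<Longrightarrow> per v \<le> per w"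
      using finite_max_obtain[of "W - U" per] fin False by auto
    obtain R' where R': "extendable (U \<union> orb w) R' w"
      using extendable_step[OF less.prems(1), of w] w(1) less.prems(3)[OF w(1)] per_dvd_per[of w y]
      by auto
    have sub: "U \<union> orb w \<subseteq> W"
      using less.prems(2) w(1) assms(4) by (auto simp: orb_def)
    have "W - (U \<union> orb w) \<subset> W - U"
      using w(1) self_orb[of w] by blast
    then have "card (W - (U \<union> orb w)) < card (W - U)"
      using fin by (intro psubset_card_mono) auto
    then show ?thesis
      using R' sub by (rule less.hyps) (use w less.prems(3) in auto)
  qed
qed

lemma represents_V_of_nonfixed:
  assumes "represents {v \<in> V. per v \<ge> 2} C" "\<And>u v. C u v \<in> K" "c \<in> K" "c' \<in> K" "c \<noteq> c'"
    and x: "x \<in> V" "per x \<ge> 2"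
  shows "\<exists>C'. represents V C' \<and> (\<forall>u v. C' u v \<in> K)"
proof -
  let ?F = "{v \<in> V. per v = 1}" and ?U = "{v \<in> V. per v \<ge> 2}"
  have "per v = 1 \<or> per v \<ge> 2" for v
    using per_pos[of v] by linarith
  then have V: "V = ?F \<union> ?U" by blast
  have "pw 1 x \<noteq> x" using pw_1_neq[OF self_orb x(2)] .
  then have "\<exists>C'. represents (?F \<union> ?U) C' \<and> (\<forall>u v. C' u v \<in> K)"
    by (intro represents_insert_fixed_points[OF assms(1-5), of "pw 1 x" x])
      (use finite_V x V_pw in auto)
  then show ?thesis using V by simp
qed

lemma represents_of_extendable:
  assumes "extendable U R y" "U \<subseteq> {v \<in> V. per v \<ge> 2}"
    and "\<And>v. v \<in> V \<Longrightarrow> v \<notin> U \<Longrightarrow> per v \<le> per y"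
  shows "\<exists>C :: 'a \<Rightarrow> 'a \<Rightarrow> nat. represents V C \<and> (\<forall>u v. C u v \<in> {0..<2})"
proof -
  have "\<exists>R :: 'a \<Rightarrow> 'a \<Rightarrow> bool. represents {v \<in> V. per v \<ge> 2} R"
    by (rule extendable_extend[OF assms(1,2)]) (use assms(3) V_pw in auto)
  then obtain R' :: "'a \<Rightarrow> 'a \<Rightarrow> bool" where R': "represents {v \<in> V. per v \<ge> 2} R'" by blast
  have "represents {v \<in> V. per v \<ge> 2} (\<lambda>u v. of_bool (R' u v) :: nat)"
    using R' by (rule represents_inj_color[where K = UNIV]) (auto simp: inj_on_def)
  moreover have "y \<in> V" "per y \<ge> 2"
    using assms(1,2) by (auto simp: extendable_def)
  ultimately show ?thesis
    by (intro represents_V_of_nonfixed[where c = 0 and c' = 1]) auto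
qed

lemma represents_two_colors:
  assumes xy: "x \<in> V" "y \<in> V" "y \<notin> orb x" and max: "\<And>v. v \<in> V \<Longrightarrow> per v \<le> per x" and "per y \<ge> 4"
    and third: "(\<exists>v\<in>V. v \<notin> orb x \<and> per v \<ge> 8) \<or> (\<exists>v\<in>V. v \<notin> orb x \<union> orb y \<and> per v \<ge> 2)"
  shows "\<exists>C :: 'a \<Rightarrow> 'a \<Rightarrow> nat. represents V C \<and> (\<forall>u v. C u v \<in> {0..<2})"
proof (cases "\<exists>v\<in>V. v \<notin> orb x \<and> per v \<ge> 8")
  case True
  then obtain w where w: "w \<in> V" "w \<notin> orb x" "per w \<ge> 8" by blast
  \<comment> \<open>The second orbit is chosen anew as a longest one outside \<open>orb x\<close>;
    it need not be that of \<open>y\<close>, and it bounds all orbits still to be attached.\<close>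
  obtain v where v: "v \<in> V - orb x" "\<And>u. u \<in> V - orb x \<Longrightarrow> per u \<le> per v"
    using finite_max_obtain[of "V - orb x" per] finite_V w by auto
  have "per v \<ge> 8" using v(2)[of w] w by auto
  then obtain R where R: "extendable (orb x \<union> orb v) R v"
    using extendable_two_large_orbits[of v x] v(1) max[of v] per_dvd_per by auto
  show ?thesis
  proof (rule represents_of_extendable[OF R])
    have "per u = per x \<or> per u = per v" if "u \<in> orb x \<union> orb v" for u
      using that per_orb by blast
    then show "orb x \<union> orb v \<subseteq> {v \<in> V. 2 \<le> per v}"
      using orb_subset[OF xy(1)] orb_subset[of v] v(1) \<open>per v \<ge> 8\<close> max[of v] by fastforce
  qed (use v in auto)
next
  case False
  then have "per y = 4" using per_less_8_cases[of y] xy \<open>per y \<ge> 4\<close> by force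
  obtain w where w: "w \<in> V" "w \<notin> orb x \<union> orb y" "per w \<ge> 2" using False third by blast
  obtain z where z: "z \<in> V - (orb x \<union> orb y)" "\<And>u. u \<in> V - (orb x \<union> orb y) \<Longrightarrow> per u \<le> per z"
    using finite_max_obtain[of "V - (orb x \<union> orb y)" per] finite_V w by auto
  have "per z \<ge> 2" using z(2)[of w] w by auto
  moreover have "per z < 8" using False z(1) by force
  ultimately have "per z \<in> {2, 4}" using per_less_8_cases[of z] by auto
  moreover have "4 dvd per x" using max[OF xy(2)] \<open>per y = 4\<close> per_dvd_per[of y x] by simp
  ultimately obtain R where R: "extendable (orb x \<union> orb y \<union> orb z) R z"
    using extendable_three_orbits[of y x z] xy(3) z(1) \<open>per y = 4\<close> not_3_dvd_per by auto
  show ?thesis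
  proof (rule represents_of_extendable[OF R])
    have "per u = per x \<or> per u = per y \<or> per u = per z" if "u \<in> orb x \<union> orb y \<union> orb z" for u
      using that per_orb by blast
    then show "orb x \<union> orb y \<union> orb z \<subseteq> {v \<in> V. 2 \<le> per v}"
      using orb_subset[OF xy(1)] orb_subset[OF xy(2)] orb_subset[of z] z(1) \<open>per y = 4\<close>
        \<open>per z \<ge> 2\<close> max[OF xy(2)] by fastforce
  qed (use z in auto)
qed

lemma represents_V_three_colors:
  assumes xy: "x \<in> V" "y \<in> V" "y \<notin> orb x" and max: "\<And>v. v \<in> V \<Longrightarrow> per v \<le> per x" and "per y = 4"
    and others: "\<And>v. v \<in> V \<Longrightarrow> v \<notin> orb x \<union> orb y \<Longrightarrow> per v = 1"
  shows "\<exists>C :: 'a \<Rightarrow> 'a \<Rightarrow> nat. represents V C \<and> (\<forall>u v. C u v \<in> {0..<3})"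
proof -
  have "4 dvd per x" using max[OF xy(2)] \<open>per y = 4\<close> per_dvd_per[of y x] by simp
  then obtain C :: "'a \<Rightarrow> 'a \<Rightarrow> nat" where C: "\<forall>u v. C u v < 3" "represents (orb x \<union> orb y) C"
    using represents_three_colors[of y x] xy \<open>per y = 4\<close> by auto
  have U: "orb x \<union> orb y = {v \<in> V. 2 \<le> per v}"
  proof
    have "per u = per x \<or> per u = per y" if "u \<in> orb x \<union> orb y" for u
      using that per_orb by blast
    then show "orb x \<union> orb y \<subseteq> {v \<in> V. 2 \<le> per v}"
      using orb_subset[OF xy(1)] orb_subset[OF xy(2)] \<open>per y = 4\<close> max[OF xy(2)] by fastforce
    show "{v \<in> V. 2 \<le> per v} \<subseteq> orb x \<union> orb y"
    proof
      fix v assume "v \<in> {v \<in> V. 2 \<le> per v}"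
      then show "v \<in> orb x \<union> orb y" using others[of v] by (cases "v \<in> orb x \<union> orb y") simp_all
    qed
  qed
  show ?thesis
    by (rule represents_V_of_nonfixed[where c = 0 and c' = 1 and x = y, of C])
      (use C xy U \<open>per y = 4\<close> in auto)
qed


text \<open>Restriction turns the total maps \<open>pw i\<close> into the extensional
  representatives used by \<open>BijGroup V\<close>.\<close>

definition grp :: "('a \<Rightarrow> 'a) set" where
  "grp = range (\<lambda>i. restrict (pw i) V)"

lemma mem_GR_of_represents:
  assumes "permutation_group grp V" "represents V C" "\<And>u v. C u v \<in> {0..<k}"
  shows "(grp, V) \<in> GR k"
proof -
  \<comment> \<open>Symmetry of \<open>C\<close> makes the value on a pair independent of its
    order.\<close>
  define E where "E e = (SOME c. \<exists>u\<in>V. \<exists>v\<in>V. u \<noteq> v \<and> e = {u, v} \<and> c = C u v)" for e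
  have E: "E {u, v} = C u v" if "u \<in> V" "v \<in> V" "u \<noteq> v" for u v
    unfolding E_def
  proof (rule some_equality)
    fix c assume "\<exists>u'\<in>V. \<exists>v'\<in>V. u' \<noteq> v' \<and> {u, v} = {u', v'} \<and> c = C u' v'"
    then show "c = C u v"
      using represents_sym[OF assms(2) that(1,2)] by (auto simp: doubleton_eq_iff)
  qed (use that in blast)
  have aut: "restrict f V \<in> Aut V E \<longleftrightarrow> aut V C f" for f
    unfolding aut_restrict_iff_mem_Aut [symmetric]
    using aut_cong[of V "\<lambda>u v. E {u, v}" f C] aut_cong[of V C f "\<lambda>u v. E {u, v}"] E by auto
  have "grp = Aut V E"
  proof
    show "grp \<subseteq> Aut V E"
    proof
      fix g assume "g \<in> grp"
      then obtain i where g: "g = restrict (pw i) V" by (auto simp: grp_def)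
      have "bij_betw (pw i) V V"
        by (rule bij_betw_byWitness[where f' = "pw (- i)"]) (use V_pw in auto)
      then have "aut V C (pw i)"
        unfolding aut_def using represents_pw[OF assms(2)] by blast
      then show "g \<in> Aut V E" using aut g by simp
    qed
    show "Aut V E \<subseteq> grp"
    proof
      fix g assume g: "g \<in> Aut V E"
      then have ext: "g \<in> extensional V"
        by (simp add: Aut_def BijGroup_def Bij_def)
      then have "aut V C g" using g aut[of g] by (simp add: extensional_restrict)
      then obtain i where "\<forall>v\<in>V. g v = pw i v" using represents_aut[OF assms(2)] by blast
      then have "g = restrict (pw i) V" using ext by (intro extensionalityI[of _ V]) auto
      then show "g \<in> grp" by (auto simp: grp_def)
    qed
  qed
  moreover have "E {u, v} \<in> {0..<k}" if "u \<in> V" "v \<in> V" "u \<noteq> v" for u v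
    using E[OF that] assms(3)[of u v] by simp
  then have "colored_graph k V E"
    using finite_V by (auto simp: colored_graph_def nsets_2_eq simp del: atLeastLessThan_iff)
  ultimately show ?thesis using assms(1) by (auto simp: GR_def)
qed

section \<open>Reflections that the colourings cannot exclude\<close>

lemma Aut_edge_pw:
  assumes "grp = Aut V E" "u \<in> V" "v \<in> V" "u \<noteq> v"
  shows "E {pw i u, pw i v} = E {u, v}"
proof -
  have "restrict (pw i) V \<in> Aut V E" using assms(1) by (auto simp: grp_def)
  then show ?thesis
    using assms(2-4) by (simp flip: aut_restrict_iff_mem_Aut add: aut_def)
qed

text \<open>Such an \<open>f\<close> agrees with some \<open>pw i\<close> on \<open>V\<close>. It
  fixes \<open>x\<close>, so this power is the identity on \<open>orb x\<close>, whereas a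
  reflection is not when the period is at least three.\<close>

lemma no_reflection:
  assumes "grp = Aut V E" "x \<in> V" "per x \<ge> 3" "aut V (\<lambda>u v. E {u, v}) f"
    and refl: "\<And>i. f (pw i x) = pw (- i) x"
  shows False
proof -
  have "restrict f V \<in> grp" using assms(1,4) by (simp add: aut_restrict_iff_mem_Aut)
  then obtain i where "restrict f V = restrict (pw i) V" by (auto simp: grp_def)
  then have f: "f v = pw i v" if "v \<in> V" for v using that by (metis restrict_apply')
  have "pw i x = x" using f[OF assms(2)] refl[of 0] by simp
  then have "pw 1 (pw i x) = pw 1 x" by simp
  then have "pw (- 1) x = pw 1 x"
    using f[OF V_pw[OF assms(2), of 1]] refl[of 1] by (simp add: add.commute)
  then show False using pw_eq_small[of "- 1" 1 x] assms(3) by simp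
qed

text \<open>Reflecting \<open>orb x\<close> sends the edge with exponents \<open>i, j\<close> to its
  translate by \<open>- (i + j)\<close> with the ends exchanged. For an edge to an outside vertex
  \<open>v\<close>, translation by \<open>2 * i\<close> returns \<open>- i\<close> to
  \<open>i\<close> and fixes \<open>v\<close>, whose period divides two. The number of colours is
  irrelevant.\<close>

lemma not_Aut_one_orbit:
  assumes Aut: "grp = Aut V E" and x: "x \<in> V" "per x \<ge> 4"
    and others: "\<And>v. v \<in> V \<Longrightarrow> v \<notin> orb x \<Longrightarrow> per v = 1 \<or> per v = 2"
  shows False
proof -
  define f where "f v = (if v \<in> orb x then flip x 0 v else v)" for v
  have fx [simp]: "f (pw i x) = pw (- i) x" for i by (simp add: f_def)
  have mixed: "E {pw (- i) x, v} = E {pw i x, v}" if "v \<in> V" "v \<notin> orb x" for i v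
  proof -
    have "pw (2 * i) v = v" using others[OF that] by (auto simp: pw_fixes_iff)
    moreover have "pw (- i) x \<noteq> v" using that(2) by auto
    ultimately show ?thesis
      using Aut_edge_pw[OF Aut V_pw[OF x(1), of "- i"] that(1), of "2 * i"] by simp
  qed
  have "aut V (\<lambda>u v. E {u, v}) f"
  proof (rule aut_involutionI)
    fix u v assume uv: "u \<in> V" "v \<in> V" "u \<noteq> v"
    consider "u \<in> orb x" "v \<in> orb x" | "u \<in> orb x" "v \<notin> orb x" | "u \<notin> orb x" "v \<in> orb x"
      | "u \<notin> orb x" "v \<notin> orb x" by blast
    then show "E {f u, f v} = E {u, v}"
    proof cases
      case 1
      then obtain i j where ij: "u = pw i x" "v = pw j x" by (auto elim!: orbE)
      have "pw (- i) x \<noteq> pw (- j) x"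
        using uv(3) pw_inj[of "i + j" "pw (- i) x" "pw (- j) x"] by (auto simp: ij)
      then show ?thesis
        using Aut_edge_pw[OF Aut V_pw[OF x(1), of "- i"] V_pw[OF x(1), of "- j"], of "i + j"]
        by (simp add: ij insert_commute)
    next
      case 2
      then show ?thesis using mixed uv by (auto simp: f_def elim!: orbE)
    next
      case 3
      then show ?thesis using mixed uv by (auto simp: f_def insert_commute elim!: orbE)
    qed (simp add: f_def)
  next
    show "f v \<in> V" "f (f v) = v" if "v \<in> V" for v
    proof -
      have "f v \<in> V \<and> f (f v) = v"
      proof (cases "v \<in> orb x")
        case True
        then obtain i where "v = pw i x" by (rule orbE)
        then show ?thesis using V_pw[OF x(1)] by simp
      qed (simp add: f_def that)
      then show "f v \<in> V" "f (f v) = v" by auto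
    qed
  qed
  then show False
    using no_reflection[OF Aut x(1) _ _ fx] x(2) by linarith
qed

text \<open>The simultaneous reflection sends \<open>i\<close> to \<open>- i\<close> on
  \<open>orb x\<close> and \<open>j\<close> to \<open>c - j\<close> on \<open>orb y\<close>, with
  \<open>c\<close> chosen so that colours of differences survive. On \<open>orb y\<close> it is
  undone by translation by \<open>2 * j - c\<close>, possibly odd, which could move vertices of
  period two; hence all other vertices are taken to be fixed.\<close>

lemma not_two_colored_Aut_two_orbits:
  assumes Aut: "grp = Aut V E" and xy: "x \<in> V" "y \<in> V" "y \<notin> orb x" and per: "per x \<ge> 4" "per y = 4"
    and two: "\<And>u v. u \<in> V \<Longrightarrow> v \<in> V \<Longrightarrow> u \<noteq> v \<Longrightarrow> E {u, v} < 2"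
    and others: "\<And>v. v \<in> V \<Longrightarrow> v \<notin> orb x \<union> orb y \<Longrightarrow> per v = 1"
  shows False
proof -
  have yx: "u \<notin> orb x" if "u \<in> orb y" for u using orb_disjoint[OF xy(3)] that by blast
  have xV: "pw i x \<in> V" and yV: "pw i y \<in> V" for i using V_pw xy by auto
  have xny: "x \<noteq> pw d y" for d using yx[of "pw d y"] self_orb[of x] mem_orb[of d y] by metis
  define g where "g d = E {x, pw d y}" for d
  have "g (d mod 4) = g d" for d
    using pw_cong[of "d mod 4" y d] per(2) by (simp add: g_def)
  moreover have "g d < 2" for d
    unfolding g_def by (rule two[OF xy(1) yV xny])
  ultimately obtain c where c: "\<And>d. g (c - d) = g d"
    using two_coloring_mod_4_reflection[of g] by blast
  have edge: "E {pw i x, pw j y} = g (j - i)" for i j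
    using Aut_edge_pw[OF Aut xy(1) yV xny, of i "j - i"] by (simp add: g_def)
  have fixed: "pw i v = v" if "v \<in> V" "v \<notin> orb x" "v \<notin> orb y" for i v
    using others[of v] that by (simp add: pw_fixes_iff)
  have mixed: "E {pw j u, v} = E {pw i u, v}" if "u \<in> {x, y}" "v \<in> V" "v \<notin> orb x" "v \<notin> orb y" for u v i j
  proof -
    have "u \<in> V" "pw i u \<noteq> v" using that xy(1,2) by auto
    then show ?thesis
      using Aut_edge_pw[OF Aut V_pw[of u i] that(2), of "j - i"] fixed[OF that(2-4)] by simp
  qed
  define f where "f v = (if v \<in> orb x then flip x 0 v else if v \<in> orb y then flip y c v else v)" for v
  have f [simp]: "f (pw i x) = pw (- i) x" "f (pw i y) = pw (c - i) y" for i
    using yx[of "pw i y"] by (simp_all add: f_def)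
  have f_other [simp]: "f v = v" if "v \<notin> orb x" "v \<notin> orb y" for v
    using that by (simp add: f_def)
  have cases: thesis
    if "\<And>i. u = pw i x \<Longrightarrow> thesis" "\<And>i. u = pw i y \<Longrightarrow> thesis"
      "u \<notin> orb x \<Longrightarrow> u \<notin> orb y \<Longrightarrow> thesis" for u thesis
    using that by (auto simp: orb_def)
  have "aut V (\<lambda>u v. E {u, v}) f"
  proof (rule aut_involutionI)
    show "f v \<in> V" "f (f v) = v" if "v \<in> V" for v
      using that xV yV by (auto intro: cases[of v])
    fix u v assume uv: "u \<in> V" "v \<in> V" "u \<noteq> v"
    have xx: "E {pw (- i) x, pw (- j) x} = E {pw i x, pw j x}" if "pw i x \<noteq> pw j x" for i j
    proof -
      have "pw (- i) x \<noteq> pw (- j) x"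
        using that pw_inj[of "i + j" "pw (- i) x" "pw (- j) x"] by auto
      then show ?thesis
        using Aut_edge_pw[OF Aut xV[of "- i"] xV[of "- j"], of "i + j"] by (simp add: insert_commute)
    qed
    have yy: "E {pw (c - i) y, pw (c - j) y} = E {pw i y, pw j y}" if "pw i y \<noteq> pw j y" for i j
    proof -
      have "pw (c - i) y \<noteq> pw (c - j) y"
        using that pw_inj[of "i + j - c" "pw (c - i) y" "pw (c - j) y"] by auto
      then show ?thesis
        using Aut_edge_pw[OF Aut yV[of "c - i"] yV[of "c - j"], of "i + j - c"]
        by (simp add: insert_commute)
    qed
    \<comment> \<open>The difference \<open>j - i\<close> becomes \<open>c - (j - i)\<close>, which
      has the same colour by the choice of \<open>c\<close>.\<close>
    have xy': "E {pw (- i) x, pw (c - j) y} = E {pw i x, pw j y}" for i j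
      using c[of "j - i"] by (simp add: edge algebra_simps)
    show "E {f u, f v} = E {u, v}"
    proof (rule cases[of u]; rule cases[of v])
      fix i j assume "u = pw i y" "v = pw j x"
      then show ?thesis using xy'[of j i] by (simp add: insert_commute)
    next
      fix i assume "u = pw i x" "v \<notin> orb x" "v \<notin> orb y"
      then show ?thesis using mixed[of x, OF _ uv(2)] by simp
    next
      fix i assume "u = pw i y" "v \<notin> orb x" "v \<notin> orb y"
      then show ?thesis using mixed[of y, OF _ uv(2)] by simp
    next
      fix i assume "v = pw i x" "u \<notin> orb x" "u \<notin> orb y"
      then show ?thesis using mixed[of x, OF _ uv(1)] by (simp add: insert_commute)
    next
      fix i assume "v = pw i y" "u \<notin> orb x" "u \<notin> orb y"
      then show ?thesis using mixed[of y, OF _ uv(1)] by (simp add: insert_commute)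
    qed (use uv(3) in \<open>simp_all add: xx yy xy'\<close>)
  qed
  then show False
    using no_reflection[OF Aut xy(1) _ _ f(1)] per(1) by linarith
qed

text \<open>Otherwise all periods are proper divisors of \<open>2 ^ n\<close>, hence divide
  \<open>2 ^ (n - 1)\<close>, and at most that many powers are distinct on \<open>V\<close>.\<close>

lemma exists_regular_orbit:
  assumes "card grp = 2 ^ n" "n \<ge> 1"
  obtains x where "x \<in> V" "per x = 2 ^ n"
proof -
  have "\<exists>x\<in>V. per x = 2 ^ n"
  proof (rule ccontr)
    assume none: "\<not> ?thesis"
    define m :: int where "m = 2 ^ (n - 1)"
    have "restrict (pw i) V = restrict (pw (i mod m)) V" for i
    proof (rule restrict_ext)
      fix v assume "v \<in> V"
      obtain e where e: "e \<le> n" "per v = 2 ^ e" using per_two_power by blast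
      then have "e \<noteq> n" using none \<open>v \<in> V\<close> by blast
      then have "int (per v) dvd m"
        using e by (auto simp: m_def intro!: le_imp_power_dvd)
      moreover have "m dvd i - i mod m" by (simp add: minus_mod_eq_mult_div)
      ultimately show "pw i v = pw (i mod m) v"
        unfolding pw_eq_iff by (rule dvd_trans)
    qed
    moreover have "i mod m \<in> {0..<m}" for i by (simp add: m_def)
    ultimately have "grp \<subseteq> (\<lambda>i. restrict (pw i) V) ` {0..<m}"
      unfolding grp_def by blast
    then have "card grp \<le> card {0..<m}"
      using card_mono card_image_le by (meson finite_atLeastLessThan_int finite_imageI order_trans)
    also have "\<dots> = 2 ^ (n - 1)" by (simp add: m_def nat_power_eq)
    also have "\<dots> < (2 :: nat) ^ n" using assms(2) by (intro power_strict_increasing) auto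
    finally show False using assms(1) by simp
  qed
  then show ?thesis using that by blast
qed

lemma perm_orbits_grp: "perm_orbits grp V = orb ` V"
proof -
  have "{g v |g. g \<in> grp} = orb v" if "v \<in> V" for v
  proof
    show "orb v \<subseteq> {g v |g. g \<in> grp}"
    proof
      fix u assume "u \<in> orb v"
      then obtain i where "u = pw i v" by (rule orbE)
      then show "u \<in> {g v |g. g \<in> grp}"
        using that by (intro CollectI exI[of _ "restrict (pw i) V"]) (simp add: grp_def)
    qed
  qed (use that in \<open>auto simp: grp_def\<close>)
  then show ?thesis
    by (auto simp: perm_orbits_def orbits_def orbit_def)
qed

end

section \<open>From the permutation group to the action of its generator\<close>

lemma cyclic_permutation_group_two_power:
  assumes "cyclic_permutation_group A V" "card A = 2 ^ n" "finite V"
  obtains \<sigma> where "two_power_action \<sigma> (2 ^ n) n V" "A = two_power_action.grp \<sigma> (2 ^ n) V"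
proof -
  interpret B: group "BijGroup V" by (rule group_BijGroup)
  obtain g where g: "g \<in> carrier (BijGroup V)" "A = generate (BijGroup V) {g}"
    using assms(1) by (auto simp: cyclic_permutation_group_def)
  have ord: "B.ord g = 2 ^ n" using B.generate_pow_card[OF g(1)] g(2) assms(2) by simp
  have gV: "g v \<in> V" if "v \<in> V" for v
    using g(1) that by (auto simp: BijGroup_def Bij_def bij_betw_def)
  \<comment> \<open>Elements of \<open>BijGroup V\<close> are \<open>undefined\<close> outside
    \<open>V\<close>; replacing this by the identity makes the power \<open>2 ^ n\<close> the
    identity on the whole type.\<close>
  define \<sigma> where "\<sigma> v = (if v \<in> V then g v else v)" for v
  have \<sigma>V: "(\<sigma> ^^ m) v \<in> V" if "v \<in> V" for m v
    using that by (induction m) (auto simp: \<sigma>_def gV)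
  have \<sigma>0: "(\<sigma> ^^ m) v = v" if "v \<notin> V" for m v
    using that by (induction m) (auto simp: \<sigma>_def)
  have pow: "g [^]\<^bsub>BijGroup V\<^esub> m = restrict (\<sigma> ^^ m) V" for m :: nat
  proof (induction m)
    case 0
    then show ?case by (simp add: BijGroup_def)
  next
    case (Suc m)
    have "a \<otimes>\<^bsub>BijGroup V\<^esub> b = compose V a b"
      if "a \<in> carrier (BijGroup V)" "b \<in> carrier (BijGroup V)" for a b
      using that by (simp add: BijGroup_def)
    then have "g [^]\<^bsub>BijGroup V\<^esub> Suc m = compose V (g [^]\<^bsub>BijGroup V\<^esub> m) g"
      using B.nat_pow_closed[OF g(1)] g(1) by (simp only: nat_pow_Suc)
    also have "\<dots> = restrict (\<sigma> ^^ Suc m) V"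
      unfolding Suc.IH funpow_Suc_right by (rule ext) (simp add: compose_def gV \<sigma>_def)
    finally show ?case .
  qed
  have "(\<sigma> ^^ 2 ^ n) v = v" for v
  proof (cases "v \<in> V")
    case True
    have "restrict (\<sigma> ^^ 2 ^ n) V = (\<lambda>x\<in>V. x)"
      using B.pow_ord_eq_1[OF g(1)] unfolding ord pow by (simp add: BijGroup_def)
    then show ?thesis using True by (metis restrict_apply')
  qed (rule \<sigma>0)
  then interpret cyclic_action \<sigma> "2 ^ n"
    by unfold_locales auto
  have "pw i v \<in> V" if "v \<in> V" for i v
    using \<sigma>V[OF that] by (simp add: pw_def)
  then interpret two_power_action \<sigma> "2 ^ n" n V
    using assms(3) by unfold_locales auto
  \<comment> \<open>The generator has finite order, so its nonnegative powers already form the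
    generated group.\<close>
  have "A = {g [^]\<^bsub>BijGroup V\<^esub> m |m. m \<in> (UNIV :: nat set)}"
    unfolding g(2) by (rule B.generate_pow_nat[OF g(1)]) (simp add: ord)
  also have "\<dots> = range (\<lambda>m :: nat. restrict (\<sigma> ^^ m) V)"
    by (simp add: pow full_SetCompr_eq)
  also have "\<dots> = grp"
  proof
    show "range (\<lambda>m :: nat. restrict (\<sigma> ^^ m) V) \<subseteq> grp"
      by (auto simp: grp_def simp flip: pw_int)
    show "grp \<subseteq> range (\<lambda>m :: nat. restrict (\<sigma> ^^ m) V)"
      by (auto simp: grp_def pw_def)
  qed
  finally show ?thesis using that two_power_action_axioms by blast
qed

theorem theorem4p8:
  fixes V :: "'a set" and A :: "('a \<Rightarrow> 'a) set" and n :: nat and k :: "nat \<Rightarrow> nat"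
  assumes "n \<ge> 2"
    and "finite V"
    and "cyclic_permutation_group A V"
    and "card A = 2 ^ n"
    and "\<And>i. i \<in> {1..n} \<Longrightarrow> k i = card {B \<in> perm_orbits A V. card B = 2 ^ i}"
  shows "((\<Sum>i=2..n. k i) = 1 \<longrightarrow> (A, V) \<notin> GR_all)
    \<and> ((\<Sum>i=2..n. k i) = 2 \<and> k 1 = 0 \<and> k 2 \<in> {1, 2} \<longrightarrow> (A, V) \<in> GR_star 3)
    \<and> (\<not> (\<Sum>i=2..n. k i) = 1 \<and> \<not> ((\<Sum>i=2..n. k i) = 2 \<and> k 1 = 0 \<and> k 2 \<in> {1, 2})
         \<longrightarrow> (A, V) \<in> GR 2)"
proof -
  obtain \<sigma> where \<sigma>: "two_power_action \<sigma> (2 ^ n) n V" "A = two_power_action.grp \<sigma> (2 ^ n) V"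
    using cyclic_permutation_group_two_power[OF assms(3,4,2)] .
  interpret two_power_action \<sigma> "2 ^ n" n V by (rule \<sigma>(1))
  have A: "A = grp" by (rule \<sigma>(2))
  have perm: "permutation_group grp V"
    using assms(3) by (simp add: cyclic_permutation_group_def A)
  obtain x where x: "x \<in> V" "per x = 2 ^ n"
    using exists_regular_orbit assms(1,4) by (auto simp: A)
  have max: "per v \<le> per x" for v
    using per_dvd_N[of v] x(2) by (simp add: dvd_imp_le)
  have "(2 :: nat) ^ 2 \<le> 2 ^ n" using assms(1) by (intro power_increasing) auto
  then have x4: "per x \<ge> 4" using x(2) by simp

  \<comment> \<open>Lengths are powers of two, so the sum of \<open>k i\<close> over
    \<open>i \<ge> 2\<close> counts the orbits of length at least four.\<close>
  define big where "big = {B \<in> orb ` V. card B \<ge> 4}"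
  have fin: "finite (orb ` V)" "finite big" using assms(2) by (auto simp: big_def)
  have k: "k i = card {B \<in> orb ` V. card B = 2 ^ i}" if "i \<in> {1..n}" for i
    using assms(5)[OF that] by (simp add: A perm_orbits_grp)
  have "(\<Sum>i=2..n. k i) = (\<Sum>i=2..n. card {B \<in> orb ` V. card B = 2 ^ i})"
    by (intro sum.cong) (auto simp: k)
  also have "\<dots> = card (\<Union>i\<in>{2..n}. {B \<in> orb ` V. card B = 2 ^ i})"
    using fin(1) by (intro card_UN_disjoint [symmetric]) auto
  also have "(\<Union>i\<in>{2..n}. {B \<in> orb ` V. card B = 2 ^ i}) = big"
  proof
    have "(2 :: nat) ^ i \<ge> 2 ^ 2" if "i \<ge> 2" for i :: nat
      using that by (intro power_increasing) auto
    then show "(\<Union>i\<in>{2..n}. {B \<in> orb ` V. card B = 2 ^ i}) \<subseteq> big"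
      by (fastforce simp: big_def)
    show "big \<subseteq> (\<Union>i\<in>{2..n}. {B \<in> orb ` V. card B = 2 ^ i})"
    proof
      fix B assume B: "B \<in> big"
      then obtain v where v: "v \<in> V" "B = orb v" "per v \<ge> 4" by (auto simp: big_def)
      obtain e where e: "e \<le> n" "per v = 2 ^ e" using per_two_power by blast
      have "e \<ge> 2"
      proof (rule ccontr)
        assume "\<not> e \<ge> 2"
        then have "e = 0 \<or> e = 1" by auto
        then show False using e v(3) by auto
      qed
      then show "B \<in> (\<Union>i\<in>{2..n}. {B \<in> orb ` V. card B = 2 ^ i})"
        using e v by auto
    qed
  qed
  finally have sum: "(\<Sum>i=2..n. k i) = card big" .
  have mem_big: "orb v \<in> big \<longleftrightarrow> per v \<ge> 4" if "v \<in> V" for v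
    using that by (auto simp: big_def)
  have orb_ne: "orb u \<noteq> orb v" if "u \<notin> orb v" for u v
    using that self_orb by blast
  have small: "per v = 1 \<or> per v = 2" if "\<not> per v \<ge> 4" for v
    using that per_less_8_cases[of v] by auto
  have two_big: "big = {orb x, orb y}"
    if "card big = 2" "y \<in> V" "y \<notin> orb x" "per y \<ge> 4" for y
  proof -
    have "{orb x, orb y} \<subseteq> big" using mem_big x that x4 by simp
    moreover have "card {orb x, orb y} = 2" using orb_ne[OF that(3)] by auto
    ultimately show ?thesis using that(1) fin(2) by (metis card_subset_eq)
  qed
  have in_big: "v \<in> orb x \<union> orb y" if "big = {orb x, orb y}" "v \<in> V" "per v \<ge> 4" for v y
    using mem_big[OF that(2)] that self_orb[of v] by blast
  have k1: "per v \<noteq> 2" if "k 1 = 0" "v \<in> V" for v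
  proof
    assume "per v = 2"
    have "\<forall>B\<in>orb ` V. card B \<noteq> 2" using that(1) k[of 1] fin(1) assms(1) by auto
    then show False using \<open>per v = 2\<close> \<open>v \<in> V\<close> by simp
  qed
  have k2: "\<exists>y\<in>V. y \<notin> orb x \<and> per y = 4" if "card big = 2" "k 2 \<in> {1, 2}"
  proof -
    have "\<not> big \<subseteq> {orb x}"
      using that(1) card_mono[of "{orb x}" big] by auto
    then obtain B where "B \<in> big" "B \<noteq> orb x" by blast
    moreover from \<open>B \<in> big\<close> obtain y where "y \<in> V" "B = orb y" "card B \<ge> 4"
      unfolding big_def by blast
    ultimately have y: "y \<in> V" "per y \<ge> 4" "orb y \<noteq> orb x" by simp_all
    have "card {B \<in> orb ` V. card B = 2 ^ 2} \<noteq> 0"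
      using that(2) k[of 2] assms(1) by auto
    then have "{B \<in> orb ` V. card B = 2 ^ 2} \<noteq> {}" by (metis card.empty)
    then obtain w where w: "w \<in> V" "per w = 4" by auto
    have "y \<notin> orb x" using y(3) orb_eq by blast
    \<comment> \<open>If the orbit of length four is \<open>orb x\<close> itself, then four is the
      maximal length and the other long orbit has length four as well.\<close>
    show ?thesis
    proof (cases "w \<in> orb x")
      case True
      then have "per x = 4" using per_orb[OF True] w(2) by simp
      then have "per y = 4" using max[of y] y(2) by simp
      then show ?thesis using y(1) \<open>y \<notin> orb x\<close> by blast
    qed (use w in blast)
  qed

  have "(A, V) \<notin> GR_all" if "card big = 1"
  proof
    assume "(A, V) \<in> GR_all"
    then obtain E where E: "grp = Aut V E" by (auto simp: GR_all_def GR_def A)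
    have "big = {orb x}"
      using that mem_big[OF x(1)] x4 by (auto simp: card_1_singleton_iff)
    then show False
      using not_Aut_one_orbit[OF E x(1) x4] small mem_big self_orb by blast
  qed
  moreover have "(A, V) \<in> GR_star 3" if "card big = 2" "k 1 = 0" "k 2 \<in> {1, 2}"
  proof -
    from k2[OF that(1,3)] obtain y where y: "y \<in> V" "y \<notin> orb x" "per y = 4" by blast
    \<comment> \<open>Length two is excluded by \<open>k 1 = 0\<close>, longer orbits by
      \<open>card big = 2\<close>.\<close>
    have others: "per v = 1" if "v \<in> V" "v \<notin> orb x \<union> orb y" for v
      using small[of v] k1[OF \<open>k 1 = 0\<close> that(1)] in_big[OF two_big[OF \<open>card big = 2\<close> y(1,2)] that(1)]
        that(2) y(3) by auto
    have "(A, V) \<in> GR 3"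
      using represents_V_three_colors[OF x(1) y(1,2) max y(3) others] mem_GR_of_represents[OF perm]
      unfolding A by blast
    moreover have "(A, V) \<notin> GR 2"
    proof
      assume "(A, V) \<in> GR 2"
      then obtain E where E: "grp = Aut V E" "colored_graph 2 V E" by (auto simp: GR_def A)
      have "E {u, v} < 2" if "u \<in> V" "v \<in> V" "u \<noteq> v" for u v
        using E(2) that by (auto simp: colored_graph_def Pi_iff)
      then show False
        using not_two_colored_Aut_two_orbits[OF E(1) x(1) y(1,2) x4 y(3) _ others] by blast
    qed
    ultimately show ?thesis by (simp add: GR_star_def)
  qed
  moreover have "(A, V) \<in> GR 2"
    if not1: "card big \<noteq> 1" and not2: "\<not> (card big = 2 \<and> k 1 = 0 \<and> k 2 \<in> {1, 2})"
  proof -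
    have "\<not> big \<subseteq> {orb x}"
    proof
      assume "big \<subseteq> {orb x}"
      then have "big = {orb x}" using mem_big[OF x(1)] x4 by auto
      then show False using not1 by simp
    qed
    then obtain B where "B \<in> big" "B \<noteq> orb x" by blast
    moreover from \<open>B \<in> big\<close> obtain y where "y \<in> V" "B = orb y" "card B \<ge> 4"
      unfolding big_def by blast
    ultimately have y: "y \<in> V" "per y \<ge> 4" "orb y \<noteq> orb x" by simp_all
    have yx: "y \<notin> orb x" using y(3) orb_eq by blast
    have "(\<exists>v\<in>V. v \<notin> orb x \<and> per v \<ge> 8) \<or> (\<exists>v\<in>V. v \<notin> orb x \<union> orb y \<and> per v \<ge> 2)"
    proof (rule ccontr)
      \<comment> \<open>If both alternatives fail, \<open>orb y\<close> has length four and all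
        vertices outside the two orbits are fixed, which is the configuration ruled out by
        \<open>not2\<close>.\<close>
      assume none: "\<not> ?thesis"
      have y4: "per y = 4" using none per_less_8_cases[of y] y(1,2) yx by force
      have "big \<subseteq> {orb x, orb y}"
      proof
        fix B assume "B \<in> big"
        then obtain v where v: "v \<in> V" "B = orb v" "per v \<ge> 4" by (auto simp: big_def)
        then have "v \<in> orb x \<or> v \<in> orb y" using none by force
        then show "B \<in> {orb x, orb y}" using v(2) orb_eq by blast
      qed
      then have big: "big = {orb x, orb y}" using mem_big x(1) x4 y(1,2) by blast
      then have "card big = 2" using y(3) by auto
      moreover have "k 1 = 0"
      proof -
        have "per v \<noteq> 2" if "v \<in> V" for v
        proof
          assume "per v = 2"
          then have "v \<in> orb x \<or> v \<in> orb y" using none that by force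
          then show False using per_orb[of v x] per_orb[of v y] \<open>per v = 2\<close> x4 y(2) by auto
        qed
        then have "{B \<in> orb ` V. card B = 2 ^ 1} = {}" by auto
        moreover have "k 1 = card {B \<in> orb ` V. card B = 2 ^ 1}" using k[of 1] assms(1) by simp
        ultimately show ?thesis by (simp only: card.empty)
      qed
      moreover have "k 2 \<in> {1, 2}"
      proof -
        let ?S = "{B \<in> orb ` V. card B = 2 ^ 2}"
        \<comment> \<open>\<open>k 2\<close> counts \<open>orb y\<close>, and also
          \<open>orb x\<close> when \<open>n = 2\<close>; nothing else is long.\<close>
        have "card {orb y} \<le> card ?S" using y(1) y4 fin(1) by (intro card_mono) auto
        moreover have "card ?S \<le> card big" using fin(2) by (intro card_mono) (auto simp: big_def)
        moreover have "k 2 = card ?S" using k[of 2] assms(1) by simp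
        ultimately show ?thesis using \<open>card big = 2\<close> by auto
      qed
      ultimately show False using not2 by blast
    qed
    then show ?thesis
      using represents_two_colors[OF x(1) y(1) yx max y(2)] mem_GR_of_represents[OF perm]
      unfolding A by blast
  qed
  ultimately show ?thesis unfolding sum by blast
qed

end
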